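(* For each $j=1,\dots,m$, consider the support function of the single-input integrator reach set $\mathcal{R}_j(\{\bm{x}_0\},t)\subset\mathbb{R}^{r_j}$ (defined in the context), which is $$h_{\mathcal{R}_j(\{\bm{x}_0\},t)}(\bm{y}_j)=\left\langle\bm{y}_j,\exp(t\bm{A}_j)\bm{x}_{j0}+\nu_j\bm{\zeta}_j(t)\right\rangle+\mu_j\int_0^t|\langle\bm{y}_j,\bm{\xi}_j(s)\rangle|\,\mathrm{d}s.$$ This formula has the following geometric meaning. The integral term is the support function of a scaled zonoid. The set $\mathcal{R}_j(\{\bm{x}_0\},t)$ is then a translated zonoid, with a time-varying translation of amount $\exp(t\bm{A}_j)\bm{x}_{j0}+\nu_j\bm{\zeta}_j(t)$. There is an extra translation term compared to the authors' earlier formula for the single-input case with symmetric input interval $[-\mu,\mu]$.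
   Context: The integrator dynamics in Brunovsky normal form with $d$ states and $m$ inputs is $\dot{\bm{x}}=\bm{A}\bm{x}+\bm{B}\bm{u}$ with $\bm{A}=\mathrm{blkdiag}(\bm{A}_1,\dots,\bm{A}_m)$, $\bm{B}=\mathrm{blkdiag}(\bm{b}_1,\dots,\bm{b}_m)$, relative degree vector $(r_1,\dots,r_m)^{\top}\in\mathbb{N}^m$ and $r_1+\dots+r_m=d$. Here $\bm{A}_j$ is the $r_j\times r_j$ matrix with ones on the superdiagonal and zeros elsewhere, and $\bm{b}_j\in\mathbb{R}^{r_j}$ is the last standard basis vector. The input set is the box $\mathcal{U}=[\alpha_1,\beta_1]\times\dots\times[\alpha_m,\beta_m]$. The initial condition $\bm{x}_0\in\mathbb{R}^d$ is fixed, with subvectors $\bm{x}_{j0}\in\mathbb{R}^{r_j}$. The set $\mathcal{R}_j(\{\bm{x}_0\},t)$ is the set of states that $\dot{\bm{x}}_j=\bm{A}_j\bm{x}_j+\bm{b}_ju_j$, $\bm{x}_j(0)=\bm{x}_{j0}$, may reach at time $t$ with $u_j$ taking values in $[\alpha_j,\beta_j]$. Define $\mu_j=\frac{\beta_j-\alpha_j}{2}$, $\nu_j=\frac{\beta_j+\alpha_j}{2}$, $\bm{\xi}_j(s)=\left(\frac{s^{r_j-1}}{(r_j-1)!},\frac{s^{r_j-2}}{(r_j-2)!},\dots,s,1\right)^{\top}$, and $\bm{\zeta}_j(t)=\int_0^t\bm{\xi}_j(s)\,\mathrm{d}s$. The support function of a compact convex set $\mathcal{K}$ is $h_{\mathcal{K}}(\bm{y})=\sup_{\bm{x}\in\mathcal{K}}\langle\bm{y},\bm{x}\rangle$.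 A zonotope is a finite Minkowski sum of line segments; a zonoid is a limit of zonotopes in the Hausdorff metric. *)

theory Defs
  imports "HOL-Analysis.Analysis"
begin

section \<open>Convex bodies\<close>

text \<open>The supremum is a real number; it is meaningful for bounded nonempty \<open>K\<close>.\<close>

definition support_function :: "'a::euclidean_space set \<Rightarrow> 'a \<Rightarrow> real" where
  "support_function K y = (SUP x\<in>K. y \<bullet> x)"

text \<open>Meaningful for bounded nonempty arguments.\<close>

definition hausdorff_distance :: "'a::metric_space set \<Rightarrow> 'a set \<Rightarrow> real" where
  "hausdorff_distance K L = max (SUP x\<in>K. infdist x L) (SUP y\<in>L. infdist y K)"

text \<open>The sum is the Minkowski sum of sets (from \<open>Set_Algebras\<close>).\<close>

definition zonotope :: "'a::euclidean_space set \<Rightarrow> bool" where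
  "zonotope K \<longleftrightarrow> (\<exists>(n::nat) a b. K = (\<Sum>i<n. closed_segment (a i) (b i)))"

definition zonoid :: "'a::euclidean_space set \<Rightarrow> bool" where
  "zonoid K \<longleftrightarrow> compact K \<and> K \<noteq> {} \<and>
     (\<exists>Z. (\<forall>n. zonotope (Z n)) \<and> (\<lambda>n. hausdorff_distance (Z n) K) \<longlonglongrightarrow> 0)"


section \<open>Matrix exponential\<close>

text \<open>The library multiplication \<open>*\<close> and power \<open>^\<close> on \<open>real ^ 'n ^ 'n\<close> act entrywise, so the
  library constant \<open>exp\<close> is not the matrix exponential.\<close>

definition matrix_exp :: "real ^ 'n ^ 'n \<Rightarrow> real ^ 'n ^ 'n" where
  "matrix_exp A = (\<Sum>k. (((\<lambda>M. A ** M) ^^ k) (mat 1)) /\<^sub>R fact k)"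


section \<open>Integrators\<close>

text \<open>Coordinates of \<open>real ^ 'n\<close> are listed in the order of \<open>'n\<close>;
  \<open>pos i\<close> is the zero-based position of \<open>i\<close> in this list.\<close>

definition pos :: "'n::{finite,linorder} \<Rightarrow> nat" where
  "pos i = card {k. k < i}"

lemma strict_mono_pos: "strict_mono (pos :: 'n::{finite,linorder} \<Rightarrow> nat)"
  unfolding pos_def by (intro strict_monoI psubset_card_mono) auto

lemma bij_betw_pos: "bij_betw (pos :: 'n::{finite,linorder} \<Rightarrow> nat) UNIV {..<CARD('n)}"
proof -
  have inj: "inj (pos :: 'n \<Rightarrow> nat)"
    by (rule strict_mono_imp_inj_on [OF strict_mono_pos])
  have "pos i < CARD('n)" for i :: 'n
    unfolding pos_def by (intro psubset_card_mono) auto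
  then have "range (pos :: 'n \<Rightarrow> nat) \<subseteq> {..<CARD('n)}" by auto
  moreover have "card (range (pos :: 'n \<Rightarrow> nat)) = card {..<CARD('n)}"
    using inj by (simp add: card_image)
  ultimately have "range (pos :: 'n \<Rightarrow> nat) = {..<CARD('n)}"
    by (intro card_subset_eq) auto
  with inj show ?thesis by (simp add: bij_betw_def)
qed

definition integrator_A :: "real ^ 'n::{finite,linorder} ^ 'n::{finite,linorder}" where
  "integrator_A = (\<chi> i k. if pos k = pos i + 1 then 1 else 0)"

definition integrator_b :: "real ^ 'n::{finite,linorder}" where
  "integrator_b = (\<chi> i. if pos i + 1 = CARD('n) then 1 else 0)"

definition xi :: "real \<Rightarrow> real ^ 'n::{finite,linorder}" where
  "xi s = (\<chi> i. s ^ (CARD('n) - 1 - pos i) / fact (CARD('n) - 1 - pos i))"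

definition zeta :: "real \<Rightarrow> real ^ 'n::{finite,linorder}" where
  "zeta t = integral {0..t} xi"

text \<open>The part of \<open>x\<close> formed by \<open>CARD('n)\<close> consecutive coordinates, after the first \<open>k\<close> ones.\<close>

definition subvector :: "nat \<Rightarrow> real ^ 'd::{finite,linorder} \<Rightarrow> real ^ 'n::{finite,linorder}" where
  "subvector k x = (\<chi> i. x $ (THE l. pos l = k + pos i))"

text \<open>Solutions on \<open>[0, t]\<close> of \<open>x' = A x + b u\<close> with a measurable input are in the sense of
  Caratheodory, that is, they are the continuous solutions of the integral equation.\<close>

definition trajectory ::
  "real ^ 'n ^ 'n \<Rightarrow> real ^ 'n \<Rightarrow> (real \<Rightarrow> real) \<Rightarrow> real \<Rightarrow> (real \<Rightarrow> real ^ 'n) \<Rightarrow> bool" where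
  "trajectory A b u t x \<longleftrightarrow> continuous_on {0..t} x \<and>
     (\<forall>s\<in>{0..t}. ((\<lambda>\<tau>. A *v x \<tau> + u \<tau> *\<^sub>R b) has_integral (x s - x 0)) {0..s})"

definition reach_set ::
  "real ^ 'n ^ 'n \<Rightarrow> real ^ 'n \<Rightarrow> real set \<Rightarrow> (real ^ 'n) set \<Rightarrow> real \<Rightarrow> (real ^ 'n) set" where
  "reach_set A b U X0 t =
     {x t | x u. u \<in> borel_measurable (lebesgue_on {0..t}) \<and> (\<forall>s\<in>{0..t}. u s \<in> U) \<and>
                 trajectory A b u t x \<and> x 0 \<in> X0}"

abbreviation integrator_reach_set ::
  "real set \<Rightarrow> (real ^ 'n::{finite,linorder}) set \<Rightarrow> real \<Rightarrow> (real ^ 'n::{finite,linorder}) set" where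
  "integrator_reach_set \<equiv> reach_set integrator_A integrator_b"

end

(* Since exp(sA) b = xi(s), variation of constants gives
   x(t) = exp(tA) x(0) + int_0^t u(s) xi(t - s) ds.  Writing u = nu + mu v with |v| <= 1, the reach set
   is a translate of mu Z, where Z consists of all integrals of v(s) xi(t - s).  The support function
   of Z in direction y is attained at v = sgn <y, xi(t - s)>, and Riemann sums approximate Z by
   zonotopes.  Closedness of Z needs no weak compactness: for y <> 0 the polynomial <y, xi> has finitely
   many roots, so the support function is differentiable at y, the face of the closure of Z in
   direction y is a single point, and this point is the integral attained by the sign control.  A
   convex set that contains all such boundary points of its closure is closed. *)

theory Submission
  imports Defs
begin

section \<open>The zonoid of a bounded scalar control\<close>

text \<open>An input is only bounded and measurable, so the product rule cannot be applied pointwise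
  to a trajectory. Variation of constants is therefore obtained by pairing the trajectory with the
  rows of exp((t - s)A), which are polynomial in s and solve the adjoint equation; the integration
  by parts behind it rests on a second-order estimate of increments. The converse inclusion needs a
  trajectory for every input, and the chain structure of the integrator supplies one by repeated
  integration. Compactness belongs to the notion of zonoid, which is why Z has to be closed and not
  merely approximable. The intervals [\<alpha>, \<beta>] and [-\<mu>, \<mu>] lead to the same Z:
  they differ only in their midpoint, and the midpoint \<nu> contributes the translation \<nu>
  zeta(t). The cases t = 0 and \<mu> = 0 run through the general argument, helped by the convention
  x / 0 = 0.\<close>

lemma integrable_bounded_measurable_scaleR:
  fixes f :: "real \<Rightarrow> 'a::euclidean_space"
  assumes v: "v \<in> borel_measurable (lebesgue_on {a..b})"
    and bound: "\<And>s. s \<in> {a..b} \<Longrightarrow> \<bar>v s\<bar> \<le> M"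
    and f: "continuous_on {a..b} f"
  shows "(\<lambda>s. v s *\<^sub>R f s) integrable_on {a..b}"
proof (rule measurable_bounded_by_integrable_imp_integrable)
  have "f \<in> borel_measurable (lebesgue_on {a..b})"
    using f by (intro continuous_imp_measurable_on_sets_lebesgue) auto
  with v show "(\<lambda>s. v s *\<^sub>R f s) \<in> borel_measurable (lebesgue_on {a..b})"
    by (intro borel_measurable_scaleR)
  show "(\<lambda>s. M * norm (f s)) integrable_on {a..b}"
    by (intro integrable_continuous_real continuous_intros f)
  show "norm (v s *\<^sub>R f s) \<le> M * norm (f s)" if "s \<in> {a..b}" for s
    using bound[OF that] by (simp add: mult_right_mono)
qed auto

text \<open>A maximiser determines the supremum outright, so no separate proof is needed that the
  values are bounded above, which a real \<open>SUP\<close> would otherwise demand.\<close>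

lemma support_function_eqI:
  assumes "z \<in> K" and "y \<bullet> z = h" and "\<And>x. x \<in> K \<Longrightarrow> y \<bullet> x \<le> h"
  shows "support_function K y = h"
  unfolding support_function_def using assms by (intro cSup_eq_maximum) auto

text \<open>This is the Aumann integral of the segments from \<open>- f s\<close> to
  \<open>f s\<close>. The symmetric bound on \<open>v\<close> keeps the centred body apart from the
  midpoint of the input interval.\<close>

definition control_zonoid :: "real \<Rightarrow> (real \<Rightarrow> 'a::euclidean_space) \<Rightarrow> 'a set" where
  "control_zonoid t f = {integral {0..t} (\<lambda>s. v s *\<^sub>R f s) | v.
     v \<in> borel_measurable (lebesgue_on {0..t}) \<and> (\<forall>s\<in>{0..t}. \<bar>v s\<bar> \<le> 1)}"

lemma control_zonoidI:
  "v \<in> borel_measurable (lebesgue_on {0..t}) \<Longrightarrow> (\<And>s. s \<in> {0..t} \<Longrightarrow> \<bar>v s\<bar> \<le> 1) \<Longrightarrow>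
     integral {0..t} (\<lambda>s. v s *\<^sub>R f s) \<in> control_zonoid t f"
  unfolding control_zonoid_def by blast

lemma borel_measurable_sgn_inner:
  fixes f :: "real \<Rightarrow> 'a::euclidean_space"
  assumes "continuous_on {a..b} f"
  shows "(\<lambda>s. sgn (y \<bullet> f s)) \<in> borel_measurable (lebesgue_on {a..b})"
proof -
  have "(\<lambda>s. y \<bullet> f s) \<in> borel_measurable (lebesgue_on {a..b})"
    using assms by (intro continuous_imp_measurable_on_sets_lebesgue continuous_intros) auto
  then show ?thesis by measurable
qed

text \<open>Here \<open>y\<close> selects the control and \<open>w\<close> only tests the resulting
  point: \<open>w = y\<close> gives the maximal value, while arbitrary \<open>w\<close> is needed to
  compare the point with directional derivatives of the support function at
  \<open>y\<close>.\<close>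

lemma inner_integral_sgn:
  fixes f :: "real \<Rightarrow> 'a::euclidean_space"
  assumes "continuous_on {0..t} f"
  shows "w \<bullet> integral {0..t} (\<lambda>s. sgn (y \<bullet> f s) *\<^sub>R f s) =
         integral {0..t} (\<lambda>s. sgn (y \<bullet> f s) * (w \<bullet> f s))"
proof -
  have "(\<lambda>s. sgn (y \<bullet> f s) *\<^sub>R f s) integrable_on {0..t}"
    by (rule integrable_bounded_measurable_scaleR[where M=1,
          OF borel_measurable_sgn_inner[OF assms] _ assms])
       (simp add: abs_sgn_eq)
  then show ?thesis
    by (subst integral_linear[OF _ bounded_linear_inner_right, symmetric]) (auto simp: o_def)
qed

lemma control_zonoid_exposed:
  assumes "continuous_on {0..t} f"
  shows "integral {0..t} (\<lambda>s. sgn (y \<bullet> f s) *\<^sub>R f s) \<in> control_zonoid t f"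
    and "y \<bullet> integral {0..t} (\<lambda>s. sgn (y \<bullet> f s) *\<^sub>R f s) = integral {0..t} (\<lambda>s. \<bar>y \<bullet> f s\<bar>)"
proof -
  show "integral {0..t} (\<lambda>s. sgn (y \<bullet> f s) *\<^sub>R f s) \<in> control_zonoid t f"
    by (rule control_zonoidI) (use borel_measurable_sgn_inner[OF assms] in \<open>auto simp: abs_sgn_eq\<close>)
  show "y \<bullet> integral {0..t} (\<lambda>s. sgn (y \<bullet> f s) *\<^sub>R f s) = integral {0..t} (\<lambda>s. \<bar>y \<bullet> f s\<bar>)"
    by (simp add: inner_integral_sgn[OF assms] sgn_mult_self_eq abs_sgn mult.commute)
qed

lemma control_zonoid_inner_le:
  assumes f: "continuous_on {0..t} f" and z: "z \<in> control_zonoid t f"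
  shows "y \<bullet> z \<le> integral {0..t} (\<lambda>s. \<bar>y \<bullet> f s\<bar>)"
proof -
  obtain v where v: "v \<in> borel_measurable (lebesgue_on {0..t})"
      "\<And>s. s \<in> {0..t} \<Longrightarrow> \<bar>v s\<bar> \<le> 1" "z = integral {0..t} (\<lambda>s. v s *\<^sub>R f s)"
    using z unfolding control_zonoid_def by blast
  note int = integrable_bounded_measurable_scaleR[OF v(1,2) f]
  have "y \<bullet> z = integral {0..t} (\<lambda>s. y \<bullet> (v s *\<^sub>R f s))"
    using integral_linear[OF int bounded_linear_inner_right, of y] unfolding v(3) o_def by (rule sym)
  also have "\<dots> \<le> integral {0..t} (\<lambda>s. \<bar>y \<bullet> f s\<bar>)"
  proof (rule integral_le)
    show "(\<lambda>s. y \<bullet> (v s *\<^sub>R f s)) integrable_on {0..t}"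
      using integrable_linear[OF int bounded_linear_inner_right] by (simp add: o_def)
    show "(\<lambda>s. \<bar>y \<bullet> f s\<bar>) integrable_on {0..t}"
      by (intro integrable_continuous_real continuous_intros f)
    show "y \<bullet> (v s *\<^sub>R f s) \<le> \<bar>y \<bullet> f s\<bar>" if "s \<in> {0..t}" for s
    proof -
      have "y \<bullet> (v s *\<^sub>R f s) \<le> \<bar>v s\<bar> * \<bar>y \<bullet> f s\<bar>"
        by (metis abs_ge_self abs_mult inner_scaleR_right)
      also have "\<dots> \<le> \<bar>y \<bullet> f s\<bar>"
        using v(2)[OF that] by (simp add: mult_left_le_one_le)
      finally show ?thesis .
    qed
  qed
  finally show ?thesis .
qed

lemma support_function_control_zonoid:
  assumes "continuous_on {0..t} f"
  shows "support_function (control_zonoid t f) y = integral {0..t} (\<lambda>s. \<bar>y \<bullet> f s\<bar>)"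
  by (rule support_function_eqI[OF control_zonoid_exposed control_zonoid_inner_le]) (rule assms)+

lemma bounded_control_zonoid:
  assumes f: "continuous_on {0..t} f"
  shows "bounded (control_zonoid t f)"
proof (rule boundedI)
  fix z assume "z \<in> control_zonoid t f"
  then obtain v where v: "v \<in> borel_measurable (lebesgue_on {0..t})"
      "\<And>s. s \<in> {0..t} \<Longrightarrow> \<bar>v s\<bar> \<le> 1" "z = integral {0..t} (\<lambda>s. v s *\<^sub>R f s)"
    unfolding control_zonoid_def by blast
  show "norm z \<le> integral {0..t} (\<lambda>s. norm (f s))"
    unfolding v(3)
  proof (rule Henstock_Kurzweil_Integration.integral_norm_bound_integral)
    show "(\<lambda>s. v s *\<^sub>R f s) integrable_on {0..t}"
      by (rule integrable_bounded_measurable_scaleR[OF v(1,2) f])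
    show "(\<lambda>s. norm (f s)) integrable_on {0..t}"
      by (intro integrable_continuous_real continuous_intros f)
    show "norm (v s *\<^sub>R f s) \<le> norm (f s)" if "s \<in> {0..t}" for s
      using v(2)[OF that] by (simp add: mult_left_le_one_le)
  qed
qed

lemma convex_control_zonoid:
  assumes f: "continuous_on {0..t} f"
  shows "convex (control_zonoid t f)"
proof (rule convexI)
  fix x z and p q :: real
  assume x: "x \<in> control_zonoid t f" and z: "z \<in> control_zonoid t f"
    and pq: "0 \<le> p" "0 \<le> q" "p + q = 1"
  obtain v where v: "v \<in> borel_measurable (lebesgue_on {0..t})"
      "\<And>s. s \<in> {0..t} \<Longrightarrow> \<bar>v s\<bar> \<le> 1" "x = integral {0..t} (\<lambda>s. v s *\<^sub>R f s)"
    using x unfolding control_zonoid_def by blast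
  obtain w where w: "w \<in> borel_measurable (lebesgue_on {0..t})"
      "\<And>s. s \<in> {0..t} \<Longrightarrow> \<bar>w s\<bar> \<le> 1" "z = integral {0..t} (\<lambda>s. w s *\<^sub>R f s)"
    using z unfolding control_zonoid_def by blast
  note iv = integrable_bounded_measurable_scaleR[OF v(1,2) f]
   and iw = integrable_bounded_measurable_scaleR[OF w(1,2) f]
  have "p *\<^sub>R x + q *\<^sub>R z = integral {0..t} (\<lambda>s. p *\<^sub>R v s *\<^sub>R f s + q *\<^sub>R w s *\<^sub>R f s)"
    unfolding v(3) w(3)
    by (subst integral_add) (auto intro!: integrable_cmul iv iw simp del: scaleR_scaleR)
  also have "\<dots> = integral {0..t} (\<lambda>s. (p * v s + q * w s) *\<^sub>R f s)"
    by (simp add: algebra_simps)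
  also have "\<dots> \<in> control_zonoid t f"
  proof (rule control_zonoidI)
    show "(\<lambda>s. p * v s + q * w s) \<in> borel_measurable (lebesgue_on {0..t})"
      using v(1) w(1) by measurable
    show "\<bar>p * v s + q * w s\<bar> \<le> 1" if "s \<in> {0..t}" for s
    proof -
      have "\<bar>p * v s + q * w s\<bar> \<le> p * \<bar>v s\<bar> + q * \<bar>w s\<bar>"
        using pq by (metis abs_mult abs_of_nonneg abs_triangle_ineq)
      also have "\<dots> \<le> p * 1 + q * 1"
        using pq v(2)[OF that] w(2)[OF that] by (intro add_mono mult_left_mono) auto
      finally show ?thesis using pq by simp
    qed
  qed
  finally show "p *\<^sub>R x + q *\<^sub>R z \<in> control_zonoid t f" .
qed

text \<open>Comparing \<open>z\<close> with the support function along \<open>y + w / k\<close>, where it is differentiable at \<open>y\<close>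
  with gradient \<open>?z\<close>, gives \<open>w \<bullet> z \<le> w \<bullet> ?z\<close> for every \<open>w\<close>.\<close>

lemma control_zonoid_exposed_unique:
  fixes f :: "real \<Rightarrow> 'a::euclidean_space"
  assumes f: "continuous_on {0..t} f"
    and null: "negligible {s\<in>{0..t}. y \<bullet> f s = 0}"
    and below: "\<And>w. w \<bullet> z \<le> integral {0..t} (\<lambda>s. \<bar>w \<bullet> f s\<bar>)"
    and attained: "y \<bullet> z = integral {0..t} (\<lambda>s. \<bar>y \<bullet> f s\<bar>)"
  shows "z = integral {0..t} (\<lambda>s. sgn (y \<bullet> f s) *\<^sub>R f s)"
    (is "z = ?z")
proof -
  have le: "w \<bullet> z \<le> w \<bullet> ?z" for w
  proof -
    define e :: "nat \<Rightarrow> real" where "e = (\<lambda>k. 1 / (real k + 1))"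
    have e: "e k > 0" for k by (simp add: e_def)
    have e0: "e \<longlonglongrightarrow> 0" using LIMSEQ_Suc[OF lim_1_over_n] by (simp add: e_def add.commute)
    define q where "q = (\<lambda>k s. (\<bar>(y + e k *\<^sub>R w) \<bullet> f s\<bar> - \<bar>y \<bullet> f s\<bar>) / e k)"
    \<comment> \<open>The pointwise limit of \<open>q\<close>: at a root of
      \<open>y \<bullet> f s\<close> the quotient is constantly
      \<open>\<bar>w \<bullet> f s\<bar>\<close>, elsewhere it tends to the derivative of the
      absolute value. The hypothesis \<open>null\<close> later replaces the first case by the
      second.\<close>
    define g where "g = (\<lambda>s. if y \<bullet> f s = 0 then \<bar>w \<bullet> f s\<bar> else sgn (y \<bullet> f s) * (w \<bullet> f s))"
    have int_q: "q k integrable_on {0..t}" for k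
      unfolding q_def using e[of k]
      by (intro integrable_continuous_real continuous_intros f) auto
    have "(\<lambda>k. integral {0..t} (q k)) \<longlonglongrightarrow> integral {0..t} g"
    proof (rule dominated_convergence(2))
      show "(\<lambda>s. \<bar>w \<bullet> f s\<bar>) integrable_on {0..t}"
        by (intro integrable_continuous_real continuous_intros f)
      \<comment> \<open>The reverse triangle inequality cancels \<open>e k\<close> and leaves a
        dominating function independent of \<open>k\<close>.\<close>
      show "norm (q k s) \<le> \<bar>w \<bullet> f s\<bar>" for k s
      proof -
        have "\<bar>\<bar>(y + e k *\<^sub>R w) \<bullet> f s\<bar> - \<bar>y \<bullet> f s\<bar>\<bar> \<le> \<bar>e k * (w \<bullet> f s)\<bar>"
          by (simp add: inner_add_left)
        also have "\<dots> = e k * \<bar>w \<bullet> f s\<bar>" using e[of k] by (simp add: abs_mult)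
        finally show ?thesis using e[of k] by (simp add: q_def field_simps)
      qed
      show "(\<lambda>k. q k s) \<longlonglongrightarrow> g s" for s
      proof (cases "y \<bullet> f s = 0")
        case True
        then have "q k s = g s" for k
          using e[of k] by (simp add: q_def g_def inner_add_left abs_mult)
        then show ?thesis by simp
      next
        case False
        have "(\<lambda>k. e k * (w \<bullet> f s)) \<longlonglongrightarrow> 0" using tendsto_mult_left_zero[OF e0] .
        \<comment> \<open>A perturbation smaller than \<open>\<bar>y \<bullet> f s\<bar>\<close>
          cannot flip the sign, so the absolute value is affine there and the quotient equals its
          limit already.\<close>
        then have "\<forall>\<^sub>F k in sequentially. \<bar>e k * (w \<bullet> f s)\<bar> < \<bar>y \<bullet> f s\<bar>"
          using False order_tendstoD(2)[OF tendsto_rabs_zero, of _ sequentially "\<bar>y \<bullet> f s\<bar>"] by simp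
        then have "\<forall>\<^sub>F k in sequentially. q k s = g s"
        proof eventually_elim
          case (elim k)
          then have "\<bar>(y + e k *\<^sub>R w) \<bullet> f s\<bar> - \<bar>y \<bullet> f s\<bar> = sgn (y \<bullet> f s) * (e k * (w \<bullet> f s))"
            using False unfolding inner_add_left inner_scaleR_left sgn_if by auto
          then show ?case using e[of k] False by (simp add: q_def g_def)
        qed
        then show ?thesis by (rule tendsto_eventually)
      qed
    qed (rule int_q)
    moreover have "w \<bullet> z \<le> integral {0..t} (q k)" for k
    proof -
      have "e k * (w \<bullet> z) = (y + e k *\<^sub>R w) \<bullet> z - y \<bullet> z" by (simp add: inner_add_left)
      also have "\<dots> \<le> integral {0..t} (\<lambda>s. \<bar>(y + e k *\<^sub>R w) \<bullet> f s\<bar>) - integral {0..t} (\<lambda>s. \<bar>y \<bullet> f s\<bar>)"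
        using below[of "y + e k *\<^sub>R w"] attained by simp
      also have "\<dots> = integral {0..t} (\<lambda>s. \<bar>(y + e k *\<^sub>R w) \<bullet> f s\<bar> - \<bar>y \<bullet> f s\<bar>)"
        by (subst integral_diff)
           (auto intro!: integrable_continuous_real continuous_intros f)
      also have "\<dots> = integral {0..t} (\<lambda>s. e k * q k s)"
        using e[of k] by (simp add: q_def)
      also have "\<dots> = e k * integral {0..t} (q k)" by simp
      finally show ?thesis using e[of k] by simp
    qed
    ultimately have "w \<bullet> z \<le> integral {0..t} g"
      by (intro LIMSEQ_le_const) auto
    also have "\<dots> = integral {0..t} (\<lambda>s. sgn (y \<bullet> f s) * (w \<bullet> f s))"
      by (rule integral_spike[OF null]) (auto simp: g_def)
    finally show ?thesis by (simp add: inner_integral_sgn[OF f])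
  qed
  \<comment> \<open>Testing with \<open>w = z - ?z\<close> bounds the squared distance of the two
    points by 0.\<close>
  have "(z - ?z) \<bullet> (z - ?z) \<le> 0"
    using le[of "z - ?z"] by (simp add: inner_diff_right)
  then have "(z - ?z) \<bullet> (z - ?z) = 0"
    by (intro antisym inner_ge_zero)
  then show ?thesis
    by (simp only: inner_eq_zero_iff right_minus_eq)
qed

lemma closed_control_zonoid:
  fixes f :: "real \<Rightarrow> 'a::euclidean_space"
  assumes f: "continuous_on {0..t} f"
    and null: "\<And>y. y \<noteq> 0 \<Longrightarrow> negligible {s\<in>{0..t}. y \<bullet> f s = 0}"
  shows "closed (control_zonoid t f)"
proof -
  let ?K = "control_zonoid t f"
  have K: "convex ?K" by (rule convex_control_zonoid[OF f])
  have "z \<in> ?K" if z: "z \<in> closure ?K" for z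
  proof (cases "z \<in> rel_interior ?K")
    case True
    then show ?thesis using rel_interior_subset by blast
  next
    case False
    \<comment> \<open>A convex set and its closure share their relative interior, so
      \<open>z\<close> lies on the relative boundary of the closure and has a supporting
      hyperplane.\<close>
    then have "z \<notin> rel_interior (closure ?K)"
      by (simp add: convex_rel_interior_closure[OF K])
    then obtain a where a: "a \<noteq> 0" "\<And>x. x \<in> closure ?K \<Longrightarrow> a \<bullet> z \<le> a \<bullet> x"
      using supporting_hyperplane_rel_boundary[OF convex_closure[OF K] z] by metis
    have below: "w \<bullet> z \<le> integral {0..t} (\<lambda>s. \<bar>w \<bullet> f s\<bar>)" for w
    proof -
      have "closure ?K \<subseteq> {x. w \<bullet> x \<le> integral {0..t} (\<lambda>s. \<bar>w \<bullet> f s\<bar>)}"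
        by (rule closure_minimal) (auto intro: control_zonoid_inner_le[OF f] closed_halfspace_le)
      with z show ?thesis by blast
    qed
    \<comment> \<open>The normal \<open>a\<close> is minimised at \<open>z\<close>, hence the
      direction that exposes \<open>z\<close> as a maximiser is \<open>-a\<close>.\<close>
    have "integral {0..t} (\<lambda>s. \<bar>(-a) \<bullet> f s\<bar>) \<le> (-a) \<bullet> z"
      using a(2)[OF subsetD[OF closure_subset control_zonoid_exposed(1)[OF f]], of "-a"]
        control_zonoid_exposed(2)[OF f, of "-a"] by simp
    with below[of "-a"] have "(-a) \<bullet> z = integral {0..t} (\<lambda>s. \<bar>(-a) \<bullet> f s\<bar>)" by (rule antisym)
    with below have "z = integral {0..t} (\<lambda>s. sgn ((-a) \<bullet> f s) *\<^sub>R f s)"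
      using a(1) by (intro control_zonoid_exposed_unique[OF f null]) auto
    then show ?thesis using control_zonoid_exposed(1)[OF f, of "-a"] by simp
  qed
  then have "closure ?K = ?K" using closure_subset by blast
  then show ?thesis using closure_eq by blast
qed


section \<open>Approximation by zonotopes\<close>

lemma integral_uniform_partition:
  fixes F :: "real \<Rightarrow> 'a::banach"
  assumes "0 \<le> h" and "F integrable_on {0..real n * h}"
  shows "integral {0..real n * h} F = (\<Sum>i<n. integral {real i * h..real (Suc i) * h} F)"
  using assms(2)
proof (induction n)
  case (Suc n)
  have le: "0 \<le> real n * h" "real n * h \<le> real (Suc n) * h"
    using \<open>0 \<le> h\<close> by (auto simp: mult_right_mono)
  have "F integrable_on {0..real n * h}"
    using le by (intro integrable_subinterval_real[OF Suc.prems]) auto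
  then show ?case
    using Henstock_Kurzweil_Integration.integral_combine[OF le Suc.prems] Suc.IH by simp
qed simp

text \<open>With coefficients in [-1, 1] instead of [0, 1], a coefficient can be read as the value
  of a control on a cell; \<open>(1 + l) / 2\<close> converts between the two ranges.\<close>

lemma closed_segment_symmetric:
  fixes a :: "'a::real_vector"
  shows "closed_segment (- a) a = {l *\<^sub>R a | l. \<bar>l\<bar> \<le> 1}"
proof (intro set_eqI iffI)
  fix x assume "x \<in> closed_segment (- a) a"
  then obtain u where u: "0 \<le> u" "u \<le> 1" "x = (1 - u) *\<^sub>R (- a) + u *\<^sub>R a"
    unfolding closed_segment_def by blast
  have "x = (u - (1 - u)) *\<^sub>R a" unfolding u(3) scaleR_left_diff_distrib by simp
  moreover have "\<bar>u - (1 - u)\<bar> \<le> 1" using u by simp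
  ultimately show "x \<in> {l *\<^sub>R a | l. \<bar>l\<bar> \<le> 1}" by blast
next
  fix x assume "x \<in> {l *\<^sub>R a | l. \<bar>l\<bar> \<le> 1}"
  then obtain l where l: "\<bar>l\<bar> \<le> 1" "x = l *\<^sub>R a" by blast
  have "x = ((1 + l) / 2 - (1 - (1 + l) / 2)) *\<^sub>R a" unfolding l(2) by (simp add: field_simps)
  then have "x = (1 - (1 + l) / 2) *\<^sub>R (- a) + ((1 + l) / 2) *\<^sub>R a"
    unfolding scaleR_left_diff_distrib by simp
  moreover have "0 \<le> (1 + l) / 2" "(1 + l) / 2 \<le> 1" using l by auto
  ultimately show "x \<in> closed_segment (- a) a"
    unfolding closed_segment_def by blast
qed

lemma sum_symmetric_segments:
  fixes a :: "nat \<Rightarrow> 'a::real_vector"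
  shows "(\<Sum>i<n. closed_segment (- a i) (a i)) = {\<Sum>i<n. l i *\<^sub>R a i | l. \<forall>i<n. \<bar>l i\<bar> \<le> 1}"
proof (intro set_eqI iffI)
  fix x assume "x \<in> (\<Sum>i<n. closed_segment (- a i) (a i))"
  then obtain s where s: "x = (\<Sum>i<n. s i)" "\<forall>i<n. s i \<in> closed_segment (- a i) (a i)"
    by (auto simp: set_sum_alt)
  from s(2) obtain l where l: "\<forall>i<n. s i = l i *\<^sub>R a i \<and> \<bar>l i\<bar> \<le> 1"
    unfolding closed_segment_symmetric mem_Collect_eq by metis
  then have "x = (\<Sum>i<n. l i *\<^sub>R a i)" using s(1) by simp
  with l show "x \<in> {\<Sum>i<n. l i *\<^sub>R a i | l. \<forall>i<n. \<bar>l i\<bar> \<le> 1}" by blast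
next
  fix x assume "x \<in> {\<Sum>i<n. l i *\<^sub>R a i | l. \<forall>i<n. \<bar>l i\<bar> \<le> 1}"
  then show "x \<in> (\<Sum>i<n. closed_segment (- a i) (a i))"
    by (auto simp: set_sum_alt closed_segment_symmetric)
qed

text \<open>The pointwise bound \<open>e\<close> serves twice: it bounds the suprema from above, and
  it makes the families bounded, without which a real \<open>SUP\<close> of nonnegative values need
  not be nonnegative.\<close>

lemma hausdorff_distance_bounds:
  assumes ne: "K \<noteq> {}" "L \<noteq> {}"
    and KL: "\<And>x. x \<in> K \<Longrightarrow> \<exists>y\<in>L. dist x y \<le> e"
    and LK: "\<And>y. y \<in> L \<Longrightarrow> \<exists>x\<in>K. dist y x \<le> e"
  shows "0 \<le> hausdorff_distance K L" and "hausdorff_distance K L \<le> e"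
proof -
  have K: "infdist x L \<le> e" if "x \<in> K" for x
    using KL[OF that] infdist_le2 by blast
  have L: "infdist y K \<le> e" if "y \<in> L" for y
    using LK[OF that] infdist_le2 by blast
  show "hausdorff_distance K L \<le> e"
    unfolding hausdorff_distance_def using ne K L by (intro max.boundedI cSUP_least)
  obtain x where x: "x \<in> K" using ne by blast
  have "0 \<le> (SUP x\<in>K. infdist x L)"
    by (rule cSUP_upper2[OF _ x]) (auto intro: bdd_aboveI2[where M=e] K infdist_nonneg)
  then show "0 \<le> hausdorff_distance K L"
    unfolding hausdorff_distance_def by simp
qed

text \<open>Only \<open>f\<close> is frozen at the left end of each cell, while \<open>v\<close>
  keeps its exact cell integral. Each cell costs at most \<open>h * e\<close>, whatever the
  regularity of \<open>v\<close>, so one estimate serves both directions of the Hausdorff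
  comparison.\<close>

lemma control_integral_riemann_error:
  fixes f :: "real \<Rightarrow> 'a::euclidean_space"
  assumes h: "0 \<le> h" and t: "t = real n * h"
    and f: "continuous_on {0..t} f"
    and v: "v \<in> borel_measurable (lebesgue_on {0..t})" "\<And>s. s \<in> {0..t} \<Longrightarrow> \<bar>v s\<bar> \<le> 1"
    and osc: "\<And>s s'. s \<in> {0..t} \<Longrightarrow> s' \<in> {0..t} \<Longrightarrow> \<bar>s - s'\<bar> \<le> h \<Longrightarrow> norm (f s - f s') \<le> e"
  shows "norm (integral {0..t} (\<lambda>s. v s *\<^sub>R f s) -
           (\<Sum>i<n. integral {real i * h..real (Suc i) * h} v *\<^sub>R f (real i * h))) \<le> t * e"
proof -
  let ?I = "\<lambda>i. {real i * h..real (Suc i) * h}"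
  have sub: "?I i \<subseteq> {0..t}" if "i < n" for i
  proof -
    have "0 \<le> real i * h" using h by simp
    moreover have "real (Suc i) * h \<le> t"
      unfolding t using that h by (intro mult_right_mono) auto
    ultimately show ?thesis by auto
  qed
  have int_vf: "(\<lambda>s. v s *\<^sub>R f s) integrable_on {0..t}"
    by (rule integrable_bounded_measurable_scaleR[OF v f])
  have int_v: "v integrable_on {0..t}"
    using integrable_bounded_measurable_scaleR[OF v continuous_on_const[of _ "1::real"]] by simp
  have piece: "norm (integral (?I i) (\<lambda>s. v s *\<^sub>R f s) - integral (?I i) v *\<^sub>R f (real i * h)) \<le> h * e"
    if i: "i < n" for i
  proof -
    have hi: "real i * h \<in> ?I i" using h by (simp add: mult_right_mono)
    have iv: "v integrable_on ?I i"
      by (rule integrable_subinterval_real[OF int_v sub[OF i]])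
    have ivf: "(\<lambda>s. v s *\<^sub>R f s) integrable_on ?I i"
      by (rule integrable_subinterval_real[OF int_vf sub[OF i]])
    have iv': "((\<lambda>s. v s *\<^sub>R f (real i * h)) has_integral integral (?I i) v *\<^sub>R f (real i * h)) (?I i)"
      by (rule has_integral_scaleR_left[OF integrable_integral[OF iv]])
    have "((\<lambda>s. v s *\<^sub>R f s - v s *\<^sub>R f (real i * h)) has_integral
        (integral (?I i) (\<lambda>s. v s *\<^sub>R f s) - integral (?I i) v *\<^sub>R f (real i * h))) (?I i)"
      by (rule has_integral_diff[OF integrable_integral[OF ivf] iv'])
    moreover have "norm (v s *\<^sub>R f s - v s *\<^sub>R f (real i * h)) \<le> e" if s: "s \<in> ?I i - {}" for s
    proof -
      have "norm (v s *\<^sub>R f s - v s *\<^sub>R f (real i * h)) = \<bar>v s\<bar> * norm (f s - f (real i * h))"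
        by (metis norm_scaleR scaleR_right_diff_distrib)
      also have "\<dots> \<le> 1 * norm (f s - f (real i * h))"
        using v(2) subsetD[OF sub[OF i]] s by (intro mult_right_mono) auto
      also have "norm (f s - f (real i * h)) \<le> e"
      proof (rule osc)
        show "\<bar>s - real i * h\<bar> \<le> h" using s by (simp add: algebra_simps)
      qed (use s hi sub[OF i] in blast)+
      finally show ?thesis by simp
    qed
    moreover have "0 \<le> e"
      using osc[OF subsetD[OF sub[OF i] hi] subsetD[OF sub[OF i] hi]] h by simp
    ultimately have "norm (integral (?I i) (\<lambda>s. v s *\<^sub>R f s) - integral (?I i) v *\<^sub>R f (real i * h))
        \<le> e * Henstock_Kurzweil_Integration.content (?I i)"
      by (intro has_integral_bound_real[OF _ finite.emptyI]) auto
    then show ?thesis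
      using h by (simp add: algebra_simps)
  qed
  have "norm (integral {0..t} (\<lambda>s. v s *\<^sub>R f s) -
           (\<Sum>i<n. integral (?I i) v *\<^sub>R f (real i * h)))
      = norm (\<Sum>i<n. integral (?I i) (\<lambda>s. v s *\<^sub>R f s) - integral (?I i) v *\<^sub>R f (real i * h))"
    using integral_uniform_partition[OF h int_vf[unfolded t]] unfolding t sum_subtractf by (simp only:)
  also have "\<dots> \<le> (\<Sum>i<n. h * e)"
    using piece by (intro sum_norm_le) auto
  also have "\<dots> = t * e" by (simp add: t)
  finally show ?thesis .
qed

lemma exists_step_control:
  fixes l :: "nat \<Rightarrow> real"
  assumes h: "0 \<le> h" and l: "\<And>i. i < n \<Longrightarrow> \<bar>l i\<bar> \<le> 1"
  obtains v where "v \<in> borel_measurable borel" and "\<And>s. \<bar>v s\<bar> \<le> 1"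
    and "\<And>i. i < n \<Longrightarrow> integral {real i * h..real (Suc i) * h} v = l i * h"
proof -
  \<comment> \<open>The default 0 keeps the control bounded by 1 on the whole line.\<close>
  define L where "L = (\<lambda>k::int. if 0 \<le> k \<and> nat k < n then l (nat k) else 0)"
  define v where "v = (\<lambda>s. L \<lfloor>s / h\<rfloor>)"
  show thesis
  proof
    have [measurable]: "L \<in> borel_measurable (count_space UNIV)" by simp
    show "v \<in> borel_measurable borel" unfolding v_def by measurable
    show "\<bar>v s\<bar> \<le> 1" for s
      using l by (auto simp: v_def L_def)
    fix i assume i: "i < n"
    have "((\<lambda>s. l i) has_integral (l i * h)) {real i * h..real (Suc i) * h}"
      using has_integral_const_real[of "l i" "real i * h" "real (Suc i) * h"] h
      by (simp add: algebra_simps)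
    then have "(v has_integral (l i * h)) {real i * h..real (Suc i) * h}"
    proof (rule has_integral_spike_finite[rotated -1])
      \<comment> \<open>The right endpoint is exempted because the floor jumps there. If
        \<open>h = 0\<close>, the cell consists of that endpoint alone, so a remaining
        \<open>s\<close> forces \<open>h > 0\<close>.\<close>
      fix s assume s: "s \<in> {real i * h..real (Suc i) * h} - {real (Suc i) * h}"
      then have "real i * h < real (Suc i) * h" by auto
      then have "h > 0" using h by (cases "h = 0") auto
      then have "real_of_int (int i) \<le> s / h" "s / h < real_of_int (int i) + 1"
        using s by (auto simp: field_simps)
      then have "\<lfloor>s / h\<rfloor> = int i" by (rule floor_unique)
      then have "v s = L (int i)" by (simp only: v_def)
      with i show "v s = l i" by (simp add: L_def)
    qed auto
    then show "integral {real i * h..real (Suc i) * h} v = l i * h" by (rule integral_unique)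
  qed
qed

text \<open>The zonotope \<open>Z n\<close> consists of all Riemann sums with coefficients in
  [-1, 1]. A point of \<open>Z n\<close> is matched with a step control having these coefficients,
  and a control with its cell averages.\<close>

lemma zonoid_control_zonoid:
  fixes f :: "real \<Rightarrow> 'a::euclidean_space"
  assumes t: "0 \<le> t" and f: "continuous_on {0..t} f"
    and closed: "closed (control_zonoid t f)"
  shows "zonoid (control_zonoid t f)"
proof -
  let ?K = "control_zonoid t f"
  \<comment> \<open>Using \<open>Suc n\<close> cells keeps \<open>t = real (Suc n) * h n\<close>
    valid at \<open>n = 0\<close>.\<close>
  define h where "h = (\<lambda>n. t / real (Suc n))"
  have h: "0 \<le> h n" "t = real (Suc n) * h n" for n
    using t by (auto simp: h_def)
  define a where "a = (\<lambda>n i. h n *\<^sub>R f (real i * h n))"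
  define Z where "Z = (\<lambda>n. \<Sum>i<Suc n. closed_segment (- a n i) (a n i))"
  have ne: "?K \<noteq> {}" using control_zonoid_exposed(1)[OF f] by blast
  have Z_ne: "Z n \<noteq> {}" for n
    unfolding Z_def sum_symmetric_segments by (auto intro: exI[of _ "\<lambda>_. 0"])
  have osc: "\<exists>N. \<forall>n\<ge>N. \<forall>s\<in>{0..t}. \<forall>s'\<in>{0..t}. \<bar>s - s'\<bar> \<le> h n \<longrightarrow> norm (f s - f s') \<le> e"
    if e: "e > 0" for e
  proof -
    have "uniformly_continuous_on {0..t} f"
      by (rule compact_uniformly_continuous[OF f]) simp
    then obtain d where d: "d > 0"
      "\<And>s s'. s \<in> {0..t} \<Longrightarrow> s' \<in> {0..t} \<Longrightarrow> dist s' s < d \<Longrightarrow> dist (f s') (f s) < e"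
      using e unfolding uniformly_continuous_on_def by metis
    have "h \<longlonglongrightarrow> 0" unfolding h_def
      using LIMSEQ_Suc[OF lim_const_over_n[of t]] by simp
    then obtain N where N: "\<And>n. n \<ge> N \<Longrightarrow> norm (h n - 0) < d"
      using LIMSEQ_D[OF _ d(1)] by blast
    show ?thesis
    proof (intro exI[of _ N] allI impI ballI)
      fix n s s' assume "N \<le> n" and s: "s \<in> {0..t}" "s' \<in> {0..t}" and "\<bar>s - s'\<bar> \<le> h n"
      then have "dist s s' < d" using N[of n] by (simp add: dist_real_def)
      from d(2)[OF s(2,1) this] show "norm (f s - f s') \<le> e" by (simp add: dist_norm)
    qed
  qed
  have bounds: "0 \<le> hausdorff_distance (Z n) ?K \<and> hausdorff_distance (Z n) ?K \<le> t * e"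
    if e: "\<forall>s\<in>{0..t}. \<forall>s'\<in>{0..t}. \<bar>s - s'\<bar> \<le> h n \<longrightarrow> norm (f s - f s') \<le> e" for n e
  proof -
    note error = control_integral_riemann_error[OF h(1)[of n] h(2)[of n] f, of _ e]
    let ?I = "\<lambda>i. {real i * h n..real (Suc i) * h n}"
    have ZK: "\<exists>y\<in>?K. dist x y \<le> t * e" if "x \<in> Z n" for x
    proof -
      from that obtain l where l: "x = (\<Sum>i<Suc n. l i *\<^sub>R a n i)" "\<forall>i<Suc n. \<bar>l i\<bar> \<le> 1"
        unfolding Z_def sum_symmetric_segments by blast
      obtain v where v: "v \<in> borel_measurable borel" "\<And>s. \<bar>v s\<bar> \<le> 1"
        "\<And>i. i < Suc n \<Longrightarrow> integral (?I i) v = l i * h n"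
        using exists_step_control[OF h(1)[of n], of "Suc n" l] l(2) by blast
      have v': "v \<in> borel_measurable (lebesgue_on {0..t})"
        by (intro measurable_restrict_space1 measurable_completion)
           (use v(1) in simp)
      have "x = (\<Sum>i<Suc n. integral (?I i) v *\<^sub>R f (real i * h n))"
        unfolding l(1) a_def by (intro sum.cong refl) (simp only: lessThan_iff v(3) scaleR_scaleR)
      then have "dist x (integral {0..t} (\<lambda>s. v s *\<^sub>R f s)) \<le> t * e"
        using error[OF v' v(2)] e by (simp add: dist_norm norm_minus_commute)
      moreover have "integral {0..t} (\<lambda>s. v s *\<^sub>R f s) \<in> ?K"
        by (rule control_zonoidI[OF v' v(2)])
      ultimately show ?thesis by blast
    qed
    have KZ: "\<exists>x\<in>Z n. dist y x \<le> t * e" if "y \<in> ?K" for y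
    proof -
      from that obtain v where v: "v \<in> borel_measurable (lebesgue_on {0..t})"
        "\<And>s. s \<in> {0..t} \<Longrightarrow> \<bar>v s\<bar> \<le> 1" "y = integral {0..t} (\<lambda>s. v s *\<^sub>R f s)"
        unfolding control_zonoid_def by blast
      have int_v: "v integrable_on {0..t}"
        using integrable_bounded_measurable_scaleR[OF v(1,2) continuous_on_const[of _ "1::real"]]
        by simp
      \<comment> \<open>The average of \<open>v\<close> over the cell, which is 0 by convention if
        the cell has width 0.\<close>
      define l where "l = (\<lambda>i. integral (?I i) v / h n)"
      have small: "\<bar>integral (?I i) v\<bar> \<le> h n" if i: "i < Suc n" for i
      proof -
        have "real (Suc i) * h n \<le> t"
          unfolding h(2)[of n] using i h(1)[of n] by (intro mult_right_mono) auto
        moreover have "0 \<le> real i * h n" using h(1)[of n] by simp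
        ultimately have sub: "?I i \<subseteq> {0..t}" by auto
        have "norm (integral (?I i) v) \<le> 1 * Henstock_Kurzweil_Integration.content (?I i)"
        proof (rule has_integral_bound_real[OF _ finite.emptyI integrable_integral])
          show "v integrable_on ?I i" by (rule integrable_subinterval_real[OF int_v sub])
          show "norm (v s) \<le> 1" if "s \<in> ?I i - {}" for s
            using v(2)[OF subsetD[OF sub]] that by simp
        qed simp
        then show ?thesis using h(1)[of n] by (simp add: algebra_simps)
      qed
      have l1: "\<bar>l i\<bar> \<le> 1" if "i < Suc n" for i
        using small[OF that] h(1)[of n] by (cases "h n = 0") (auto simp: l_def divide_le_eq)
      have "(\<Sum>i<Suc n. integral (?I i) v *\<^sub>R f (real i * h n)) = (\<Sum>i<Suc n. l i *\<^sub>R a n i)"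
      proof (rule sum.cong)
        fix i assume "i \<in> {..<Suc n}"
        \<comment> \<open>For \<open>h n = 0\<close> this bound forces the cell integral to be 0, in
          agreement with \<open>l i * h n\<close>.\<close>
        then have "\<bar>integral (?I i) v\<bar> \<le> h n" by (intro small) simp
        then have "l i * h n = integral (?I i) v" by (cases "h n = 0") (auto simp: l_def)
        then show "integral (?I i) v *\<^sub>R f (real i * h n) = l i *\<^sub>R a n i" by (simp add: a_def)
      qed simp
      moreover have "(\<Sum>i<Suc n. l i *\<^sub>R a n i) \<in> Z n"
        unfolding Z_def sum_symmetric_segments using l1 by blast
      moreover have "dist y (\<Sum>i<Suc n. integral (?I i) v *\<^sub>R f (real i * h n)) \<le> t * e"
        unfolding v(3) dist_norm by (rule error[OF v(1,2)]) (use e in auto)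
      ultimately show ?thesis by metis
    qed
    show ?thesis by (intro conjI hausdorff_distance_bounds[OF Z_ne[of n] ne ZK KZ])
  qed
  have "(\<lambda>n. hausdorff_distance (Z n) ?K) \<longlonglongrightarrow> 0"
  proof (rule LIMSEQ_I)
    fix r :: real assume r: "r > 0"
    \<comment> \<open>Dividing by \<open>t + 1\<close> instead of \<open>t\<close> covers
      \<open>t = 0\<close> and makes \<open>t * e < r\<close> strict.\<close>
    define e where "e = r / (t + 1)"
    have e: "e > 0" "t * e < r" using r t by (auto simp: e_def field_simps)
    obtain N where N: "\<forall>n\<ge>N. \<forall>s\<in>{0..t}. \<forall>s'\<in>{0..t}. \<bar>s - s'\<bar> \<le> h n \<longrightarrow> norm (f s - f s') \<le> e"
      using osc[OF e(1)] by blast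
    show "\<exists>N. \<forall>n\<ge>N. norm (hausdorff_distance (Z n) ?K - 0) < r"
    proof (intro exI[of _ N] allI impI)
      fix n assume "N \<le> n"
      then show "norm (hausdorff_distance (Z n) ?K - 0) < r"
        using bounds[OF spec[OF N, THEN mp], of n] e by simp
    qed
  qed
  moreover have "zonotope (Z n)" for n
    unfolding zonotope_def Z_def 
    by (rule exI[of _ "Suc n"], rule exI[of _ "\<lambda>i. - a n i"], rule exI[of _ "a n"], rule refl)
  moreover have "compact ?K"
    using closed bounded_control_zonoid[OF f] by (simp add: compact_eq_bounded_closed)
  ultimately show ?thesis unfolding zonoid_def using ne by blast
qed


section \<open>Trajectories of linear systems\<close>

text \<open>Difference quotients are at most \<open>C * \<bar>q - p\<bar>\<close>, so the derivative
  vanishes at every point. This asks nothing of \<open>H\<close> beyond increments, which is all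
  that an indefinite integral of a discontinuous input provides.\<close>

lemma quadratic_increments_imp_constant:
  fixes H :: "real \<Rightarrow> real"
  assumes "\<And>p q. 0 \<le> p \<Longrightarrow> p \<le> q \<Longrightarrow> q \<le> t \<Longrightarrow> \<bar>H q - H p\<bar> \<le> C * (q - p)\<^sup>2" and "0 \<le> t"
  shows "H t = H 0"
proof -
  have "(H has_derivative (\<lambda>h. 0)) (at p within {0..t})" if p: "p \<in> {0..t}" for p
    unfolding has_derivative_within
  proof (intro conjI)
    show "((\<lambda>q. (1 / norm (q - p)) *\<^sub>R (H q - (H p + 0))) \<longlongrightarrow> 0) (at p within {0..t})"
    proof (rule Lim_null_comparison)
      show "\<forall>\<^sub>F q in at p within {0..t}. norm ((1 / norm (q - p)) *\<^sub>R (H q - (H p + 0))) \<le> C * \<bar>q - p\<bar>"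
        unfolding eventually_at_filter
      proof (intro always_eventually allI impI)
        fix q assume q: "q \<noteq> p" "q \<in> {0..t}"
        have "\<bar>H q - H p\<bar> \<le> C * (\<bar>q - p\<bar> * \<bar>q - p\<bar>)"
        proof (cases "p \<le> q")
          case True
          then show ?thesis using assms(1)[of p q] p q(2) by (simp add: power2_eq_square)
        next
          case False
          then have "\<bar>H p - H q\<bar> \<le> C * (p - q)\<^sup>2" using assms(1)[of q p] p q(2) by simp
          then show ?thesis
            using False by (simp add: power2_eq_square abs_minus_commute[of "H p"])
        qed
        then show "norm ((1 / norm (q - p)) *\<^sub>R (H q - (H p + 0))) \<le> C * \<bar>q - p\<bar>"
          using q(1) by (simp add: divide_le_eq ac_simps)
      qed
      show "((\<lambda>q. C * \<bar>q - p\<bar>) \<longlongrightarrow> 0) (at p within {0..t})"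
        by (auto intro!: tendsto_eq_intros)
    qed
  qed simp
  then obtain c where "\<forall>p\<in>{0..t}. H p = c"
    using has_derivative_zero_constant[OF convex_real_interval(5)] by blast
  with \<open>0 \<le> t\<close> show ?thesis by simp
qed

text \<open>Since \<open>w\<close> is merely bounded and integrable, \<open>x\<close> need not be differentiable outside a
  countable set, which the fundamental theorem of calculus for gauge integrals would require.\<close>

lemma integration_by_parts_inner:
  fixes g g' x w :: "real \<Rightarrow> 'a::euclidean_space"
  assumes t: "0 \<le> t"
    and g: "\<And>s. s \<in> {0..t} \<Longrightarrow> (g has_vector_derivative g' s) (at s within {0..t})"
    and g': "continuous_on {0..t} g'"
    and x: "\<And>s. s \<in> {0..t} \<Longrightarrow> (w has_integral (x s - x 0)) {0..s}"
    and w: "\<And>s. s \<in> {0..t} \<Longrightarrow> norm (w s) \<le> M"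
  shows "((\<lambda>s. g s \<bullet> w s) has_integral
           (g t \<bullet> x t - g 0 \<bullet> x 0 - integral {0..t} (\<lambda>s. g' s \<bullet> x s))) {0..t}"
proof -
  have M: "0 \<le> M" using order_trans[OF norm_ge_zero w[of 0]] t by simp
  have cg: "continuous_on {0..t} g"
    unfolding continuous_on_eq_continuous_within using g has_vector_derivative_continuous by blast
  have w_int: "w integrable_on {0..t}" using x[of t] t by auto
  have incr_w: "(w has_integral (x q - x p)) {p..q}" if pq: "0 \<le> p" "p \<le> q" "q \<le> t" for p q
  proof -
    have iq: "w integrable_on {0..q}"
      using w_int by (rule integrable_subinterval_real) (use pq in auto)
    have "integral {0..p} w + integral {p..q} w = integral {0..q} w"
      by (rule Henstock_Kurzweil_Integration.integral_combine[OF pq(1,2) iq])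
    moreover have "integral {0..p} w = x p - x 0" "integral {0..q} w = x q - x 0"
      using x[of p] x[of q] pq by (auto intro: integral_unique)
    ultimately have "integral {p..q} w = x q - x p" by (simp add: algebra_simps)
    moreover have "w integrable_on {p..q}"
      using w_int by (rule integrable_subinterval_real) (use pq in auto)
    ultimately show ?thesis by (metis integrable_integral)
  qed
  have lip_x: "norm (x q - x p) \<le> M * (q - p)" if pq: "0 \<le> p" "p \<le> q" "q \<le> t" for p q
    using has_integral_bound_real[OF M finite.emptyI incr_w[OF pq]] w pq by auto
  have cx: "continuous_on {0..t} x"
  proof -
    have "continuous_on {0..t} (\<lambda>s. x 0 + integral {0..s} w)"
      by (intro continuous_intros indefinite_integral_continuous_1 w_int)
    moreover have "x 0 + integral {0..s} w = x s" if "s \<in> {0..t}" for s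
      using integral_unique[OF x[OF that]] by simp
    ultimately show ?thesis by (rule continuous_on_eq)
  qed
  obtain L where L: "0 \<le> L" "\<And>s. s \<in> {0..t} \<Longrightarrow> norm (g' s) \<le> L"
  proof -
    have "bounded (g' ` {0..t})"
      by (intro compact_imp_bounded compact_continuous_image g') simp
    then obtain L where "\<forall>s\<in>{0..t}. norm (g' s) \<le> L" by (auto simp: bounded_iff)
    then show thesis using that[of "max L 0"] by (meson le_max_iff_disj max.cobounded2)
  qed
  have incr_g: "(g' has_integral (g q - g p)) {p..q}" if pq: "0 \<le> p" "p \<le> q" "q \<le> t" for p q
    by (rule fundamental_theorem_of_calculus[OF pq(2)])
       (rule has_vector_derivative_within_subset[OF g], use pq in auto)
  have lip_g: "norm (g q - g p) \<le> L * (q - p)" if pq: "0 \<le> p" "p \<le> q" "q \<le> t" for p q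
    using has_integral_bound_real[OF L(1) finite.emptyI incr_g[OF pq]] L(2) pq by auto
  have gw_int: "(\<lambda>s. g s \<bullet> w s) integrable_on {0..t}"
  proof (rule measurable_bounded_by_integrable_imp_integrable)
    have "g \<in> borel_measurable (lebesgue_on {0..t})"
      using cg by (intro continuous_imp_measurable_on_sets_lebesgue) auto
    moreover have "w \<in> borel_measurable (lebesgue_on {0..t})"
      using w_int by (rule integrable_imp_measurable)
    ultimately show "(\<lambda>s. g s \<bullet> w s) \<in> borel_measurable (lebesgue_on {0..t})"
      by (rule borel_measurable_inner)
    show "(\<lambda>s. norm (g s) * M) integrable_on {0..t}"
      by (intro integrable_continuous_real continuous_intros cg)
    show "norm (g s \<bullet> w s) \<le> norm (g s) * M" if "s \<in> {0..t}" for s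
      using Cauchy_Schwarz_ineq2[of "g s" "w s"] w[OF that]
      by (metis mult_left_mono norm_ge_zero order_trans real_norm_def)
  qed auto
  have gx_int: "(\<lambda>s. g' s \<bullet> x s) integrable_on {0..t}"
    by (intro integrable_continuous_real continuous_intros g' cx)
  define F where "F = (\<lambda>s. g s \<bullet> w s + g' s \<bullet> x s)"
  have F_int: "F integrable_on {0..t}"
    unfolding F_def by (intro integrable_add gw_int gx_int)
  \<comment> \<open>The product rule would make \<open>H\<close> constant. Its increments are
    integrals over \<open>{p..q}\<close> of an integrand that is itself of order
    \<open>q - p\<close>, hence quadratic.\<close>
  define H where "H = (\<lambda>s. g s \<bullet> x s - integral {0..s} F)"
  have "H t = H 0"
  proof (rule quadratic_increments_imp_constant[OF _ t])
    fix p q assume pq: "0 \<le> p" "p \<le> q" "q \<le> t"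
    have Fq: "F integrable_on {0..q}"
      using F_int by (rule integrable_subinterval_real) (use pq in auto)
    have Fpq: "F integrable_on {p..q}"
      using F_int by (rule integrable_subinterval_real) (use pq in auto)
    have "integral {0..p} F + integral {p..q} F = integral {0..q} F"
      by (rule Henstock_Kurzweil_Integration.integral_combine[OF pq(1,2) Fq])
    \<comment> \<open>The discrete product rule: one factor is frozen at \<open>q\<close>, the other
      at \<open>p\<close>, so that each increment becomes an integral of \<open>g'\<close> or of
      \<open>w\<close>.\<close>
    then have H: "H q - H p = (g q - g p) \<bullet> x q + g p \<bullet> (x q - x p) - integral {p..q} F"
      unfolding H_def by (simp add: algebra_simps inner_diff_left inner_diff_right)
    have "((\<lambda>s. g' s \<bullet> x q + g p \<bullet> w s - F s) has_integral (H q - H p)) {p..q}"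
      unfolding H
      by (rule has_integral_diff[OF has_integral_add[OF
            has_integral_linear[OF incr_g[OF pq] bounded_linear_inner_left, unfolded o_def]
            has_integral_linear[OF incr_w[OF pq] bounded_linear_inner_right, unfolded o_def]]
            integrable_integral[OF Fpq]])
    moreover have "norm (g' s \<bullet> x q + g p \<bullet> w s - F s) \<le> 2 * L * M * (q - p)" if s: "s \<in> {p..q}" for s
    proof -
      have s': "s \<in> {0..t}" using s pq by auto
      \<comment> \<open>After subtracting \<open>F\<close>, each term contains one increment. The
        Lipschitz constants \<open>M\<close> of \<open>x\<close> and \<open>L\<close> of
        \<open>g\<close> bound each term by \<open>L * M * (q - p)\<close>.\<close>
      have "g' s \<bullet> x q + g p \<bullet> w s - F s = g' s \<bullet> (x q - x s) - (g s - g p) \<bullet> w s"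
        unfolding F_def by (simp add: algebra_simps inner_diff_left inner_diff_right)
      also have "norm \<dots> \<le> norm (g' s) * norm (x q - x s) + norm (g s - g p) * norm (w s)"
        by (rule order_trans[OF norm_triangle_ineq4])
           (auto intro!: add_mono simp: Cauchy_Schwarz_ineq2)
      also have "\<dots> \<le> L * (M * (q - s)) + (L * (s - p)) * M"
        using L s s' pq w lip_x[of s q] lip_g[of p s] M
        by (intro add_mono mult_mono) auto
      also have "\<dots> \<le> L * (M * (q - p)) + (L * (q - p)) * M"
        using L M s by (intro add_mono mult_left_mono mult_right_mono) auto
      finally show ?thesis by (simp add: algebra_simps)
    qed
    moreover have "0 \<le> 2 * L * M * (q - p)" using L M pq by simp
    ultimately have "norm (H q - H p) \<le> 2 * L * M * (q - p) * Henstock_Kurzweil_Integration.content {p..q}"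
      using has_integral_bound_real[OF _ finite.emptyI] by blast
    then show "\<bar>H q - H p\<bar> \<le> (2 * L * M) * (q - p)\<^sup>2"
      using pq by (simp add: power2_eq_square algebra_simps)
  qed
  then have "integral {0..t} F = g t \<bullet> x t - g 0 \<bullet> x 0" by (simp add: H_def)
  moreover have "integral {0..t} F
      = integral {0..t} (\<lambda>s. g s \<bullet> w s) + integral {0..t} (\<lambda>s. g' s \<bullet> x s)"
    unfolding F_def by (rule integral_add[OF gw_int gx_int])
  ultimately have "integral {0..t} (\<lambda>s. g s \<bullet> w s)
      = g t \<bullet> x t - g 0 \<bullet> x 0 - integral {0..t} (\<lambda>s. g' s \<bullet> x s)" by simp
  with integrable_integral[OF gw_int] show ?thesis by metis
qed

text \<open>Pairing the trajectory with a solution \<open>p\<close> of the adjoint equation eliminates the state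
  from the integral equation.\<close>

lemma trajectory_adjoint_formula:
  fixes A :: "real ^ 'n ^ 'n"
  assumes t: "0 \<le> t" and x: "trajectory A b u t x"
    and u: "\<And>s. s \<in> {0..t} \<Longrightarrow> \<bar>u s\<bar> \<le> M"
    and p: "\<And>s. s \<in> {0..t} \<Longrightarrow> (p has_vector_derivative - (transpose A *v p s)) (at s within {0..t})"
  shows "((\<lambda>s. u s * (p s \<bullet> b)) has_integral (p t \<bullet> x t - p 0 \<bullet> x 0)) {0..t}"
proof -
  have cx: "continuous_on {0..t} x" using x by (simp add: trajectory_def)
  have cp: "continuous_on {0..t} p" 
    unfolding continuous_on_eq_continuous_within using p has_vector_derivative_continuous by blast
  have cA: "continuous_on {0..t} (\<lambda>s. B *v f s)" if "continuous_on {0..t} f"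
    for B :: "real ^ 'n ^ 'n" and f
    by (rule bounded_linear.continuous_on[OF matrix_vector_mul_bounded_linear that])
  have "bounded ((\<lambda>s. A *v x s) ` {0..t})"
    by (intro compact_imp_bounded compact_continuous_image cA cx) simp
  then obtain B where B: "\<And>s. s \<in> {0..t} \<Longrightarrow> norm (A *v x s) \<le> B"
    unfolding bounded_iff by blast
  let ?w = "\<lambda>s. A *v x s + u s *\<^sub>R b"
  have "((\<lambda>s. p s \<bullet> ?w s) has_integral
      (p t \<bullet> x t - p 0 \<bullet> x 0 - integral {0..t} (\<lambda>s. - (transpose A *v p s) \<bullet> x s))) {0..t}"
  proof (rule integration_by_parts_inner[OF t p])
    show "continuous_on {0..t} (\<lambda>s. - (transpose A *v p s))"
      by (intro continuous_intros cA cp)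
    show "(?w has_integral (x s - x 0)) {0..s}" if "s \<in> {0..t}" for s
      using x that by (simp add: trajectory_def)
    show "norm (?w s) \<le> B + M * norm b" if "s \<in> {0..t}" for s
      using B[OF that] u[OF that]
      by (intro norm_triangle_mono) (auto simp: mult_right_mono)
  qed
  moreover have "((\<lambda>s. - (transpose A *v p s) \<bullet> x s) has_integral
      integral {0..t} (\<lambda>s. - (transpose A *v p s) \<bullet> x s)) {0..t}"
    by (intro integrable_integral integrable_continuous_real continuous_intros cA cp cx)
  ultimately have "((\<lambda>s. p s \<bullet> ?w s + - (transpose A *v p s) \<bullet> x s) has_integral
      (p t \<bullet> x t - p 0 \<bullet> x 0 - integral {0..t} (\<lambda>s. - (transpose A *v p s) \<bullet> x s)
        + integral {0..t} (\<lambda>s. - (transpose A *v p s) \<bullet> x s))) {0..t}"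
    by (rule has_integral_add)
  \<comment> \<open>The transpose moves \<open>A\<close> across the inner product, so both terms
    containing the state cancel.\<close>
  moreover have "p s \<bullet> ?w s + - (transpose A *v p s) \<bullet> x s = u s * (p s \<bullet> b)" for s
    by (simp add: inner_add_right dot_lmul_matrix[symmetric] transpose_matrix_vector)
  ultimately show ?thesis by (simp only: diff_add_cancel)
qed


section \<open>Integrators\<close>

lemma pos_eq_iff [simp]: "pos i = pos k \<longleftrightarrow> i = k"
  using strict_mono_eq[OF strict_mono_pos] .

lemma pos_less_CARD: "pos (i :: 'n::{finite,linorder}) < CARD('n)"
  using bij_betw_pos bij_betwE by blast

lemma ex_pos_eq:
  assumes "k < CARD('n)"
  obtains i :: "'n::{finite,linorder}" where "pos i = k"
  using assms bij_betw_pos by (metis bij_betw_iff_bijections lessThan_iff)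

lemma sum_pos_delta:
  fixes f :: "'n::{finite,linorder} \<Rightarrow> 'a::comm_monoid_add"
  assumes "pos m = k"
  shows "(\<Sum>l\<in>UNIV. if pos l = k then f l else 0) = f m"
  unfolding assms[symmetric] by simp

text \<open>Left multiplication by the shift replaces row \<open>i\<close> by the row at the next
  position and the last row by 0, so the \<open>k\<close>-th power lives on the \<open>k\<close>-th
  superdiagonal.\<close>

lemma integrator_A_powers:
  fixes i l :: "'n::{finite,linorder}"
  shows "((\<lambda>M. (s *\<^sub>R integrator_A) ** M) ^^ k) (mat 1) $ i $ l = (if pos l = pos i + k then s ^ k else 0)"
proof (induction k arbitrary: i)
  case 0
  then show ?case by (simp add: mat_def eq_commute)
next
  case (Suc k)
  have entry: "(N ** M) $ i $ l = (\<Sum>m\<in>UNIV. N $ i $ m * M $ m $ l)"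
    for N M :: "real ^ 'n::{finite,linorder} ^ 'n::{finite,linorder}"
    by (simp add: matrix_matrix_mult_def)
  have "((\<lambda>M. (s *\<^sub>R integrator_A) ** M) ^^ Suc k) (mat 1) $ i $ l
      = (\<Sum>m::'n\<in>UNIV. if pos m = pos i + 1 then s * (if pos l = pos m + k then s ^ k else 0) else 0)"
    unfolding funpow.simps o_apply entry Suc.IH
    by (intro sum.cong) (auto simp: integrator_A_def)
  also have "\<dots> = (if pos l = pos i + Suc k then s ^ Suc k else 0)"
  proof (cases "pos i + 1 < CARD('n)")
    case True
    then obtain m :: 'n where m: "pos m = pos i + 1" by (rule ex_pos_eq)
    show ?thesis unfolding sum_pos_delta[OF m] by (simp add: m)
  next
    case False
    then have "pos m \<noteq> pos i + 1" for m :: 'n using pos_less_CARD[of m] by simp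
    moreover have "pos l \<noteq> pos i + Suc k" using False pos_less_CARD[of l] by simp
    ultimately show ?thesis by simp
  qed
  finally show ?case .
qed

text \<open>Nilpotency cuts the series off at \<open>CARD('n)\<close>, so no convergence argument is
  needed, and each entry receives at most one term.\<close>

lemma matrix_exp_integrator_A:
  fixes i l :: "'n::{finite,linorder}"
  shows "matrix_exp (s *\<^sub>R integrator_A) $ i $ l =
           (if pos i \<le> pos l then s ^ (pos l - pos i) / fact (pos l - pos i) else 0)"
proof -
  let ?P = "\<lambda>k. (((\<lambda>M :: real ^ 'n::{finite,linorder} ^ 'n::{finite,linorder}. (s *\<^sub>R integrator_A) ** M) ^^ k) (mat 1)) /\<^sub>R fact k"
  have entry: "?P k $ i $ l = (if pos l = pos i + k then s ^ k / fact k else 0)" for k and i l :: 'n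
    by (simp add: integrator_A_powers divide_inverse mult.commute)
  have "?P k = 0" if "k \<notin> {..<CARD('n)}" for k
    unfolding vec_eq_iff entry
  proof (intro allI)
    fix i l :: 'n
    have "pos l \<noteq> pos i + k" using that pos_less_CARD[of l] by simp
    then show "(if pos l = pos i + k then s ^ k / fact k else 0) = 0 $ i $ l" by simp
  qed
  then have "matrix_exp (s *\<^sub>R integrator_A) = (\<Sum>k<CARD('n). ?P k)"
    unfolding matrix_exp_def by (intro suminf_finite) auto
  then have "matrix_exp (s *\<^sub>R integrator_A) $ i $ l = (\<Sum>k<CARD('n). ?P k $ i $ l)"
    by simp
  also have "\<dots> = (\<Sum>k<CARD('n). if pos l = pos i + k then s ^ k / fact k else 0)"
    unfolding entry ..
  also have "\<dots> = (if pos i \<le> pos l then s ^ (pos l - pos i) / fact (pos l - pos i) else 0)"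
  proof (cases "pos i \<le> pos l")
    case True
    then have "(\<Sum>k<CARD('n). if pos l = pos i + k then s ^ k / fact k else 0)
        = (\<Sum>k<CARD('n). if k = pos l - pos i then s ^ k / fact k else 0)"
      by (intro sum.cong) auto
    then show ?thesis using True pos_less_CARD[of l] by simp
  qed simp
  finally show ?thesis .
qed

lemma integrator_A_mult_vector:
  fixes x :: "real ^ 'n::{finite,linorder}"
  shows "(integrator_A *v x) $ i = (\<Sum>l\<in>UNIV. if pos l = pos i + 1 then x $ l else 0)"
  unfolding matrix_vector_mult_def vec_lambda_beta
  by (intro sum.cong) (auto simp: integrator_A_def)

lemma transpose_integrator_A_mult_vector:
  fixes x :: "real ^ 'n::{finite,linorder}"
  shows "(transpose integrator_A *v x) $ i = (\<Sum>l\<in>UNIV. if pos i = pos l + 1 then x $ l else 0)"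
  unfolding matrix_vector_mult_def vec_lambda_beta
  by (intro sum.cong) (auto simp: integrator_A_def transpose_def)

text \<open>The input vector selects the last column of the exponential; this identifies
  \<open>xi\<close> as the impulse response of the integrator.\<close>

lemma matrix_exp_row_mult_integrator_b:
  fixes i :: "'n::{finite,linorder}"
  shows "(matrix_exp (s *\<^sub>R integrator_A) $ i) \<bullet> integrator_b = xi s $ i"
proof -
  have "CARD('n) - 1 < CARD('n)" by simp
  then obtain l :: 'n where l: "pos l = CARD('n) - 1" by (rule ex_pos_eq)
  have "(matrix_exp (s *\<^sub>R integrator_A) $ i) \<bullet> integrator_b
      = (\<Sum>m\<in>UNIV. if pos m = CARD('n) - 1 then matrix_exp (s *\<^sub>R integrator_A) $ i $ m else 0)"
    unfolding inner_vec_def integrator_b_def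
    by (intro sum.cong refl) (use pos_less_CARD in auto)
  also have "\<dots> = matrix_exp (s *\<^sub>R integrator_A) $ i $ l"
    by (rule sum_pos_delta[OF l])
  also have "\<dots> = xi s $ i"
    using pos_less_CARD[of i] by (auto simp: matrix_exp_integrator_A xi_def l)
  finally show ?thesis .
qed

section \<open>Adjoint solutions, variation of constants and existence of trajectories\<close>

lemma has_real_derivative_power_fact:
  "((\<lambda>s. (t - s) ^ Suc k / fact (Suc k)) has_real_derivative - ((t - s) ^ k / fact k)) (at s within S)"
proof -
  have "((\<lambda>s. (t - s) ^ Suc k / fact (Suc k)) has_real_derivative
      (real (Suc k) * (t - s) ^ k * (0 - 1)) / fact (Suc k)) (at s within S)"
    by (rule derivative_eq_intros refl | simp)+
  moreover have "(real (Suc k) * (t - s) ^ k * (0 - 1)) / fact (Suc k) = - ((t - s) ^ k / fact k)"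
    by (simp add: divide_simps del: of_nat_Suc)
  ultimately show ?thesis by simp
qed

text \<open>Row \<open>i\<close> is the adjoint solution with final value \<open>axis i 1\<close> at
  \<open>s = t\<close>, so pairing with it reads off coordinate \<open>i\<close> of the endpoint.
  The closed form of the entries reduces the claim to powers of \<open>t - s\<close>.\<close>

lemma matrix_exp_row_derivative:
  fixes i :: "'n::{finite,linorder}"
  shows "((\<lambda>s. matrix_exp ((t - s) *\<^sub>R integrator_A) $ i) has_vector_derivative
     - (transpose integrator_A *v (matrix_exp ((t - s) *\<^sub>R integrator_A) $ i))) (at s within S)"
proof -
  let ?E = "\<lambda>s. matrix_exp ((t - s) *\<^sub>R integrator_A :: real ^ 'n::{finite,linorder} ^ 'n::{finite,linorder})"
  have "((\<lambda>s. ?E s $ i $ l) has_real_derivative (- (transpose integrator_A *v (?E s $ i))) $ l)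
      (at s within S)" for l
  \<comment> \<open>Entries above the diagonal are nonconstant powers of \<open>t - s\<close>; the
    others are 0 or 1, and the adjoint right-hand side vanishes there because the matrix is upper
    triangular.\<close>
  proof (cases "pos i < pos l")
    case True
    then obtain k where k: "pos l = Suc (pos i + k)" using less_iff_Suc_add by blast
    have "pos i + k < CARD('n)" using k pos_less_CARD[of l] by simp
    then obtain m :: 'n where m: "pos m = pos i + k" by (rule ex_pos_eq)
    have "(transpose integrator_A *v (?E s $ i)) $ l
        = (\<Sum>m\<in>UNIV. if pos m = pos i + k then ?E s $ i $ m else 0)"
      unfolding transpose_integrator_A_mult_vector using k by (intro sum.cong) auto
    also have "\<dots> = (t - s) ^ k / fact k"
      unfolding sum_pos_delta[OF m] by (simp add: matrix_exp_integrator_A m)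
    moreover have "?E s $ i $ l = (t - s) ^ Suc k / fact (Suc k)" for s
      unfolding matrix_exp_integrator_A k by (simp del: power_Suc fact_Suc)
    ultimately show ?thesis using has_real_derivative_power_fact by simp
  next
    case False
    have "(transpose integrator_A *v (?E s $ i)) $ l = 0"
      unfolding transpose_integrator_A_mult_vector
      by (intro sum.neutral) (use False in \<open>auto simp: matrix_exp_integrator_A\<close>)
    moreover have "?E s $ i $ l = (if pos i = pos l then 1 else 0)" for s
      using False by (simp add: matrix_exp_integrator_A)
    ultimately show ?thesis by simp
  qed
  moreover have scale: "(\<lambda>h. (h *\<^sub>R v) $ l) = (*) (v $ l)" for v :: "real ^ 'n::{finite,linorder}" and l
    by (simp add: fun_eq_iff mult.commute)
  ultimately have "((\<lambda>s. ?E s $ i $ l) has_derivative (\<lambda>h. (h *\<^sub>R - (transpose integrator_A *v (?E s $ i))) $ l))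
      (at s within S)" for l
    unfolding has_field_derivative_def scale by blast
  then show ?thesis
    unfolding has_vector_derivative_def
    by (subst has_derivative_componentwise_within) (auto simp: Basis_vec_def inner_axis)
qed

text \<open>The adjoint formula is applied to each row separately: at \<open>t\<close> it yields a
  coordinate of \<open>x t\<close>, at 0 a coordinate of the free motion, and paired with the input
  vector a coordinate of \<open>xi (t - s)\<close>.\<close>

lemma integrator_trajectory_endpoint:
  fixes x :: "real \<Rightarrow> real ^ 'n::{finite,linorder}"
  assumes t: "0 \<le> t" and x: "trajectory integrator_A integrator_b u t x"
    and u: "\<And>s. s \<in> {0..t} \<Longrightarrow> \<bar>u s\<bar> \<le> M"
  shows "((\<lambda>s. u s *\<^sub>R xi (t - s)) has_integral
           (x t - matrix_exp (t *\<^sub>R integrator_A) *v x 0)) {0..t}"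
proof -
  have "((\<lambda>s. u s * xi (t - s) $ i) has_integral
      ((x t - matrix_exp (t *\<^sub>R integrator_A) *v x 0) $ i)) {0..t}" for i :: 'n
  proof -
    have "matrix_exp ((t - t) *\<^sub>R integrator_A) $ i = axis i 1"
      unfolding vec_eq_iff matrix_exp_integrator_A by (auto simp: axis_def power_0_left)
    then have "(matrix_exp ((t - t) *\<^sub>R integrator_A) $ i) \<bullet> x t = x t $ i"
      by (simp add: inner_axis')
    moreover have "(matrix_exp ((t - 0) *\<^sub>R integrator_A) $ i) \<bullet> x 0
        = (matrix_exp (t *\<^sub>R integrator_A) *v x 0) $ i"
      by (simp add: matrix_vector_mult_def inner_vec_def)
    ultimately show ?thesis
      using trajectory_adjoint_formula[OF t x u matrix_exp_row_derivative[of t i]]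
      by (simp only: matrix_exp_row_mult_integrator_b vector_minus_component)
  qed
  then show ?thesis
    by (subst has_integral_componentwise_iff) (auto simp: Basis_vec_def inner_axis)
qed

text \<open>The index counts the integrators between the input and a coordinate, starting at 0 for
  the last coordinate; \<open>a k\<close> is the initial value at level \<open>k\<close>.\<close>

primrec iterated_integrator :: "(nat \<Rightarrow> real) \<Rightarrow> (real \<Rightarrow> real) \<Rightarrow> nat \<Rightarrow> real \<Rightarrow> real" where
  "iterated_integrator a u 0 = (\<lambda>s. a 0 + integral {0..s} u)"
| "iterated_integrator a u (Suc k) = (\<lambda>s. a (Suc k) + integral {0..s} (iterated_integrator a u k))"

lemma iterated_integrator_0 [simp]: "iterated_integrator a u k 0 = a k"
  by (cases k) auto

lemma continuous_on_iterated_integrator: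
  assumes "u integrable_on {0..t}"
  shows "continuous_on {0..t} (iterated_integrator a u k)"
  by (induction k)
     (auto intro!: continuous_intros indefinite_integral_continuous_1 assms integrable_continuous_real)

lemma iterated_integrator_has_integral:
  assumes u: "u integrable_on {0..t}" and s: "s \<in> {0..t}"
  shows "((case k of 0 \<Rightarrow> u | Suc l \<Rightarrow> iterated_integrator a u l) has_integral
           (iterated_integrator a u k s - a k)) {0..s}"
proof -
  have "f integrable_on {0..s}" if "f integrable_on {0..t}" for f :: "real \<Rightarrow> real"
    using that by (rule integrable_subinterval_real) (use s in auto)
  then show ?thesis
    using u continuous_on_iterated_integrator[OF u]
    by (cases k) (auto intro: integrable_continuous_real simp: has_integral_integrable_integral)
qed

text \<open>Each coordinate is driven only by the next one, and the last only by the input, so the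
  system is solved by integrating from the last coordinate upwards.\<close>

lemma ex_integrator_trajectory:
  fixes x0 :: "real ^ 'n::{finite,linorder}"
  assumes u: "u integrable_on {0..t}"
  obtains x where "trajectory integrator_A integrator_b u t x" and "x 0 = x0"
proof -
  define k where "k = (\<lambda>i::'n. CARD('n) - 1 - pos i)"
  define a where "a = (\<lambda>l. x0 $ (THE i. k i = l))"
  \<comment> \<open>Positions stay below \<open>CARD('n)\<close>, so the truncated subtraction loses
    nothing and the \<open>THE\<close> in \<open>a\<close> is well defined.\<close>
  have inj_k: "k i = k l \<longleftrightarrow> i = l" for i l
    unfolding k_def using pos_less_CARD[of i] pos_less_CARD[of l] pos_eq_iff[of i l]
    by (auto simp del: pos_eq_iff)
  define x where "x = (\<lambda>s. \<chi> i. iterated_integrator a u (k i) s)"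
  have cx: "continuous_on {0..t} x"
    unfolding x_def by (intro continuous_on_vec_lambda continuous_on_iterated_integrator u)
  have a: "a (k i) = x0 $ i" for i by (simp add: a_def inj_k)
  have x0: "x 0 = x0" by (simp add: x_def vec_eq_iff a)
  have rhs: "(integrator_A *v x \<tau> + u \<tau> *\<^sub>R integrator_b) $ i
      = (case k i of 0 \<Rightarrow> u | Suc l \<Rightarrow> iterated_integrator a u l) \<tau>" for \<tau> i
  proof (cases "pos i + 1 < CARD('n)")
    case True
    then obtain m :: 'n where m: "pos m = pos i + 1" by (rule ex_pos_eq)
    have "k i = Suc (k m)" using True by (simp add: k_def m)
    then show ?thesis
      using True unfolding vector_add_component integrator_A_mult_vector sum_pos_delta[OF m]
      by (simp add: integrator_b_def x_def)
  next
    case False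
    then have last: "pos i + 1 = CARD('n)" using pos_less_CARD[of i] by simp
    have "pos m \<noteq> pos i + 1" for m :: 'n using last pos_less_CARD[of m] by simp
    then have "(integrator_A *v x \<tau>) $ i = 0" by (simp add: integrator_A_mult_vector)
    moreover have "k i = 0" using last by (simp add: k_def)
    ultimately show ?thesis using last by (simp add: integrator_b_def)
  qed
  have "((\<lambda>\<tau>. integrator_A *v x \<tau> + u \<tau> *\<^sub>R integrator_b) has_integral (x s - x 0)) {0..s}"
    if s: "s \<in> {0..t}" for s
  proof -
    have "((\<lambda>\<tau>. (integrator_A *v x \<tau> + u \<tau> *\<^sub>R integrator_b) $ i) has_integral (x s - x 0) $ i) {0..s}" for i
      using iterated_integrator_has_integral[OF u s, where k = "k i" and a = a]
      unfolding rhs by (simp add: x_def)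
    then show ?thesis
      by (subst has_integral_componentwise_iff) (auto simp: Basis_vec_def inner_axis)
  qed
  with cx have "trajectory integrator_A integrator_b u t x" by (simp add: trajectory_def)
  then show thesis using x0 by (rule that)
qed

section \<open>The curve \<open>xi\<close> and the reach set as a translated scaled zonoid\<close>

lemma continuous_on_xi: "continuous_on S (xi :: real \<Rightarrow> real ^ 'n::{finite,linorder})"
  unfolding xi_def by (intro continuous_on_vec_lambda continuous_intros) auto

lemma continuous_on_xi_reverse:
  "continuous_on S (\<lambda>s. xi (t - s) :: real ^ 'n::{finite,linorder})"
  by (rule continuous_on_compose2[OF continuous_on_xi[of UNIV]]) (auto intro!: continuous_intros)

text \<open>The components of \<open>xi\<close> are monomials of pairwise different degrees, so a
  nonzero \<open>y\<close> leaves a nonzero coefficient in the polynomial.\<close>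

lemma finite_roots_inner_xi:
  fixes y :: "real ^ 'n::{finite,linorder}"
  assumes "y \<noteq> 0"
  shows "finite {s. y \<bullet> xi s = 0}"
proof -
  let ?N = "CARD('n) - 1"
  \<comment> \<open>At most one summand is nonzero; the sum over all indices avoids naming the
    inverse of \<open>pos\<close>.\<close>
  define c where "c = (\<lambda>k. \<Sum>i\<in>UNIV. if ?N - pos i = k then y $ i / fact k else 0)"
  have "y \<bullet> xi s = (\<Sum>k\<le>?N. c k * s ^ k)" for s
  proof -
    have "(\<Sum>k\<le>?N. c k * s ^ k)
        = (\<Sum>k\<le>?N. \<Sum>i\<in>UNIV. if ?N - pos i = k then y $ i * (s ^ k / fact k) else 0)"
      unfolding c_def sum_distrib_right by (intro sum.cong) auto
    also have "\<dots> = (\<Sum>i\<in>UNIV. \<Sum>k\<le>?N. if ?N - pos i = k then y $ i * (s ^ k / fact k) else 0)"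
      by (rule sum.swap)
    also have "\<dots> = (\<Sum>i\<in>UNIV. y $ i * xi s $ i)"
      by (intro sum.cong refl) (simp add: xi_def sum.delta')
    finally show ?thesis by (simp add: inner_vec_def)
  qed
  moreover have "\<exists>k\<le>?N. c k \<noteq> 0"
  proof -
    obtain m where m: "y $ m \<noteq> 0" using assms by (auto simp: vec_eq_iff)
    have "?N - pos i = ?N - pos m \<longleftrightarrow> pos i = pos m" for i :: 'n
      using pos_less_CARD[of i] pos_less_CARD[of m] by (auto simp del: pos_eq_iff)
    then have "c (?N - pos m) = y $ m / fact (?N - pos m)"
      unfolding c_def by simp
    then show ?thesis using m by (intro exI[of _ "?N - pos m"]) simp
  qed
  ultimately show ?thesis using polyfun_finite_roots[of c ?N] by simp
qed

text \<open>Variation of constants produces \<open>xi (t - s)\<close>, whereas \<open>zeta\<close>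
  and the support function are written with \<open>xi s\<close>.\<close>

lemma integral_reverse:
  fixes f :: "real \<Rightarrow> 'a::banach"
  assumes "continuous_on {0..t} f" and t: "0 \<le> t"
  shows "integral {0..t} (\<lambda>s. f (t - s)) = integral {0..t} f"
proof -
  have "(f has_integral integral {0..t} f) (cbox 0 t)"
    using integrable_integral[OF integrable_continuous_real[OF assms(1)]] by simp
  from has_integral_affinity[OF this, of "-1" t]
  have "((\<lambda>s. f (t - s)) has_integral integral {0..t} f) ((\<lambda>x. t - x) ` {0..t})"
    by simp
  also have "(\<lambda>x. t - x) ` {0..t} = {0..t}"
  proof (intro set_eqI iffI)
    show "s \<in> (\<lambda>x. t - x) ` {0..t}" if "s \<in> {0..t}" for s
      using that by (intro image_eqI[of _ _ "t - s"]) auto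
  qed auto
  finally show ?thesis by (rule integral_unique)
qed

text \<open>Substituting \<open>u = ?nu + ?mu * v\<close> carries controls bounded by 1 onto inputs
  in the interval; the constant part integrates to the \<open>zeta\<close> term of the
  translation.\<close>

lemma integrator_reach_set_eq:
  fixes x0 :: "real ^ 'n::{finite,linorder}"
  assumes t: "0 \<le> t" and le: "\<alpha> \<le> \<beta>"
  shows "integrator_reach_set {\<alpha>..\<beta>} {x0} t =
    (+) (matrix_exp (t *\<^sub>R integrator_A) *v x0 + ((\<beta> + \<alpha>) / 2) *\<^sub>R zeta t) `
      (*\<^sub>R) ((\<beta> - \<alpha>) / 2) ` control_zonoid t (\<lambda>s. xi (t - s))"
    (is "?R = (+) ?c ` (*\<^sub>R) ?mu ` ?Z")
proof -
  let ?nu = "(\<beta> + \<alpha>) / 2" and ?f = "\<lambda>s. xi (t - s) :: real ^ 'n::{finite,linorder}"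
  have f: "continuous_on {0..t} ?f" by (rule continuous_on_xi_reverse)
  have zeta: "integral {0..t} ?f = zeta t"
    unfolding zeta_def by (rule integral_reverse[OF continuous_on_xi t])
  \<comment> \<open>For \<open>q = 0\<close> the hypothesis gives \<open>p = a\<close>, and the
    quotient 0 satisfies both claims, so a one-point input interval is covered.\<close>
  have normalize: "\<bar>(p - a) / q\<bar> \<le> 1" "p = a + q * ((p - a) / q)" if "\<bar>p - a\<bar> \<le> q" for p a q :: real
    using that by (cases "q = 0"; simp add: abs_divide)+
  have split: "integral {0..t} (\<lambda>s. u s *\<^sub>R ?f s) = ?nu *\<^sub>R zeta t + ?mu *\<^sub>R integral {0..t} (\<lambda>s. v s *\<^sub>R ?f s)"
    if v: "v \<in> borel_measurable (lebesgue_on {0..t})" "\<And>s. s \<in> {0..t} \<Longrightarrow> \<bar>v s\<bar> \<le> 1"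
      and u: "\<And>s. s \<in> {0..t} \<Longrightarrow> u s = ?nu + ?mu * v s" for u v
  proof -
    have "integral {0..t} (\<lambda>s. u s *\<^sub>R ?f s)
        = integral {0..t} (\<lambda>s. ?nu *\<^sub>R ?f s + ?mu *\<^sub>R (v s *\<^sub>R ?f s))"
      by (intro integral_cong) (simp add: u scaleR_left_distrib)
    also have "\<dots> = integral {0..t} (\<lambda>s. ?nu *\<^sub>R ?f s) + integral {0..t} (\<lambda>s. ?mu *\<^sub>R (v s *\<^sub>R ?f s))"
      by (intro integral_add integrable_cmul integrable_bounded_measurable_scaleR[OF v f]
            integrable_continuous_real f)
    finally show ?thesis by (simp only: integral_cmul zeta)
  qed
  show ?thesis
  proof (intro set_eqI iffI)
    fix z assume "z \<in> ?R"
    then obtain x u where z: "z = x t" and u: "u \<in> borel_measurable (lebesgue_on {0..t})"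
        "\<And>s. s \<in> {0..t} \<Longrightarrow> u s \<in> {\<alpha>..\<beta>}"
      and x: "trajectory integrator_A integrator_b u t x" "x 0 = x0"
      unfolding reach_set_def by blast
    define v where "v = (\<lambda>s. (u s - ?nu) / ?mu)"
    have v: "v \<in> borel_measurable (lebesgue_on {0..t})"
      unfolding v_def using u(1) by measurable
    have v1: "\<bar>v s\<bar> \<le> 1" "u s = ?nu + ?mu * v s" if "s \<in> {0..t}" for s
    proof -
      have "\<alpha> \<le> u s" "u s \<le> \<beta>" using u(2)[OF that] by auto
      then have "\<bar>u s - ?nu\<bar> \<le> ?mu" by argo
      then show "\<bar>v s\<bar> \<le> 1" "u s = ?nu + ?mu * v s"
        unfolding v_def by (rule normalize)+
    qed
    have "\<bar>u s\<bar> \<le> \<bar>\<alpha>\<bar> + \<bar>\<beta>\<bar>" if "s \<in> {0..t}" for s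
      using u(2)[OF that] by auto
    from integral_unique[OF integrator_trajectory_endpoint[OF t x(1) this]]
    have "z = matrix_exp (t *\<^sub>R integrator_A) *v x0 + integral {0..t} (\<lambda>s. u s *\<^sub>R ?f s)"
      by (simp add: z x(2))
    also have "\<dots> = ?c + ?mu *\<^sub>R integral {0..t} (\<lambda>s. v s *\<^sub>R ?f s)"
      using split[OF v v1] by simp
    finally have z': "z = ?c + ?mu *\<^sub>R integral {0..t} (\<lambda>s. v s *\<^sub>R ?f s)" .
    show "z \<in> (+) ?c ` (*\<^sub>R) ?mu ` ?Z"
      unfolding z' by (intro imageI control_zonoidI v v1(1))
  next
    fix z assume "z \<in> (+) ?c ` (*\<^sub>R) ?mu ` ?Z"
    then obtain v where v: "v \<in> borel_measurable (lebesgue_on {0..t})"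
        "\<And>s. s \<in> {0..t} \<Longrightarrow> \<bar>v s\<bar> \<le> 1"
      and z: "z = ?c + ?mu *\<^sub>R integral {0..t} (\<lambda>s. v s *\<^sub>R ?f s)"
      unfolding control_zonoid_def by blast
    define u where "u = (\<lambda>s. ?nu + ?mu * v s)"
    have u: "u \<in> borel_measurable (lebesgue_on {0..t})"
      unfolding u_def using v(1) by measurable
    have ub: "u s \<in> {\<alpha>..\<beta>}" if "s \<in> {0..t}" for s
    proof -
      have "\<bar>?mu * v s\<bar> \<le> ?mu"
        using v(2)[OF that] le by (simp add: abs_mult mult_left_le)
      then have "\<alpha> \<le> ?nu + ?mu * v s" "?nu + ?mu * v s \<le> \<beta>" by argo+
      then show ?thesis by (simp add: u_def)
    qed
    have ub': "\<bar>u s\<bar> \<le> \<bar>\<alpha>\<bar> + \<bar>\<beta>\<bar>" if "s \<in> {0..t}" for s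
      using ub[OF that] by auto
    have "u integrable_on {0..t}"
      using integrable_bounded_measurable_scaleR[OF u ub' continuous_on_const[of _ "1::real"]] by simp
    \<comment> \<open>Any trajectory for \<open>u\<close> from \<open>x0\<close> will do, since the
      endpoint formula determines \<open>x t\<close> from these data.\<close>
    then obtain x where x: "trajectory integrator_A integrator_b u t x" "x 0 = x0"
      by (rule ex_integrator_trajectory)
    have "integral {0..t} (\<lambda>s. u s *\<^sub>R ?f s) = x t - matrix_exp (t *\<^sub>R integrator_A) *v x0"
      using integral_unique[OF integrator_trajectory_endpoint[OF t x(1) ub']] x(2) by simp
    then have "x t = z"
      using split[OF v, of u] by (simp add: z u_def algebra_simps)
    with u ub x show "z \<in> ?R"
      unfolding reach_set_def mem_Collect_eq by (intro exI[of _ x] exI[of _ u]) simp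
  qed
qed

lemma support_function_translated_control_zonoid:
  assumes f: "continuous_on {0..t} f" and mu: "0 \<le> \<mu>"
  shows "support_function ((+) c ` (*\<^sub>R) \<mu> ` control_zonoid t f) y
           = y \<bullet> c + \<mu> * integral {0..t} (\<lambda>s. \<bar>y \<bullet> f s\<bar>)"
proof (rule support_function_eqI)
  show "c + \<mu> *\<^sub>R integral {0..t} (\<lambda>s. sgn (y \<bullet> f s) *\<^sub>R f s) \<in> (+) c ` (*\<^sub>R) \<mu> ` control_zonoid t f"
    using control_zonoid_exposed(1)[OF f] by blast
  show "y \<bullet> (c + \<mu> *\<^sub>R integral {0..t} (\<lambda>s. sgn (y \<bullet> f s) *\<^sub>R f s))
      = y \<bullet> c + \<mu> * integral {0..t} (\<lambda>s. \<bar>y \<bullet> f s\<bar>)"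
    by (simp only: inner_add_right inner_scaleR_right control_zonoid_exposed(2)[OF f])
  show "y \<bullet> x \<le> y \<bullet> c + \<mu> * integral {0..t} (\<lambda>s. \<bar>y \<bullet> f s\<bar>)"
    if "x \<in> (+) c ` (*\<^sub>R) \<mu> ` control_zonoid t f" for x
    using that mu control_zonoid_inner_le[OF f]
    by (auto simp: inner_add_right intro!: mult_left_mono)
qed

theorem mainTheorem5:
  fixes m :: nat
    and r :: "nat \<Rightarrow> nat"
    and \<alpha> \<beta> :: "nat \<Rightarrow> real"
    and x\<^sub>0 :: "real ^ 'd::{finite,linorder}"
    and t :: real
    and j :: nat
    and x\<^sub>j\<^sub>0 c :: "real ^ 'n::{finite,linorder}"
    and \<mu> \<nu> :: real
    and R R_sym :: "(real ^ 'n::{finite,linorder}) set"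
  assumes r_pos: "\<And>l. l \<in> {1..m} \<Longrightarrow> r l \<ge> 1"
    and state_dim: "CARD('d) = (\<Sum>l\<in>{1..m}. r l)"
    and input_box: "\<And>l. l \<in> {1..m} \<Longrightarrow> \<alpha> l \<le> \<beta> l"
    and t_nonneg: "t \<ge> 0"
    and j: "j \<in> {1..m}"
    and block_dim: "CARD('n) = r j"
    and initial_block: "x\<^sub>j\<^sub>0 = subvector (\<Sum>l\<in>{1..<j}. r l) x\<^sub>0"
    and mu: "\<mu> = (\<beta> j - \<alpha> j) / 2"
    and nu: "\<nu> = (\<beta> j + \<alpha> j) / 2"
    and reach: "R = integrator_reach_set {\<alpha> j..\<beta> j} {x\<^sub>j\<^sub>0} t"
    and reach_sym: "R_sym = integrator_reach_set {-\<mu>..\<mu>} {x\<^sub>j\<^sub>0} t"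
    and translation: "c = matrix_exp (t *\<^sub>R integrator_A) *v x\<^sub>j\<^sub>0 + \<nu> *\<^sub>R zeta t"
  shows
    "(\<forall>y. support_function R y = y \<bullet> c + \<mu> * integral {0..t} (\<lambda>s. \<bar>y \<bullet> xi s\<bar>))
     \<and>
     (\<exists>Z. zonoid Z \<and>
        (\<forall>y. support_function Z y = integral {0..t} (\<lambda>s. \<bar>y \<bullet> xi s\<bar>)) \<and>
        (\<forall>y. support_function ((*\<^sub>R) \<mu> ` Z) y = \<mu> * integral {0..t} (\<lambda>s. \<bar>y \<bullet> xi s\<bar>)) \<and>
        R = (+) c ` ((*\<^sub>R) \<mu> ` Z))
     \<and>
     (\<forall>y. support_function R_sym y =
        y \<bullet> (matrix_exp (t *\<^sub>R integrator_A) *v x\<^sub>j\<^sub>0) + \<mu> * integral {0..t} (\<lambda>s. \<bar>y \<bullet> xi s\<bar>))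
     \<and>
     (\<forall>y. support_function R y = support_function R_sym y + y \<bullet> (\<nu> *\<^sub>R zeta t))"
proof -
  let ?f = "\<lambda>s. xi (t - s) :: real ^ 'n::{finite,linorder}"
  let ?Z = "control_zonoid t ?f"
  let ?E = "matrix_exp (t *\<^sub>R integrator_A) *v x\<^sub>j\<^sub>0"
  have mu0: "0 \<le> \<mu>" using input_box[OF j] by (simp add: mu)
  have f: "continuous_on {0..t} ?f" by (rule continuous_on_xi_reverse)
  have reverse: "integral {0..t} (\<lambda>s. \<bar>y \<bullet> ?f s\<bar>) = integral {0..t} (\<lambda>s. \<bar>y \<bullet> xi s\<bar>)" for y
    by (rule integral_reverse[OF _ t_nonneg]) (intro continuous_intros continuous_on_xi)
  have R: "R = (+) c ` (*\<^sub>R) \<mu> ` ?Z"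
    unfolding reach translation mu nu by (rule integrator_reach_set_eq[OF t_nonneg input_box[OF j]])
  \<comment> \<open>The symmetric interval has midpoint 0 and the same half-width, so the zonoid is
    unchanged and only the \<open>zeta\<close> term disappears from the translation.\<close>
  have R_sym: "R_sym = (+) ?E ` (*\<^sub>R) \<mu> ` ?Z"
    using integrator_reach_set_eq[OF t_nonneg, of "-\<mu>" \<mu> x\<^sub>j\<^sub>0] mu0 unfolding reach_sym by simp
  have supp: "support_function ((+) a ` (*\<^sub>R) \<mu> ` ?Z) y = y \<bullet> a + \<mu> * integral {0..t} (\<lambda>s. \<bar>y \<bullet> xi s\<bar>)"
    for a y
    by (simp only: support_function_translated_control_zonoid[OF f mu0] reverse)
  have "negligible {s\<in>{0..t}. y \<bullet> ?f s = 0}" if "y \<noteq> 0" for y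
  proof -
    \<comment> \<open>The roots along the reversed curve are the reflections of the roots of
      \<open>y \<bullet> xi s\<close>.\<close>
    have "finite ((\<lambda>s. t - s) -` {s. y \<bullet> xi s = 0})"
      by (rule finite_vimageI[OF finite_roots_inner_xi[OF that]]) (simp add: inj_def)
    then have "finite {s\<in>{0..t}. y \<bullet> ?f s = 0}"
      by (rule rev_finite_subset) auto
    then show ?thesis by (rule negligible_finite)
  qed
  then have "zonoid ?Z"
    by (intro zonoid_control_zonoid[OF t_nonneg f] closed_control_zonoid[OF f])
  moreover have "support_function ?Z y = integral {0..t} (\<lambda>s. \<bar>y \<bullet> xi s\<bar>)" for y
    by (simp only: support_function_control_zonoid[OF f] reverse)
  moreover have "support_function ((*\<^sub>R) \<mu> ` ?Z) y = \<mu> * integral {0..t} (\<lambda>s. \<bar>y \<bullet> xi s\<bar>)" for y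
    \<comment> \<open>The scaled zonoid is treated as its translate by 0.\<close>
    using supp[of 0 y] by (simp add: image_image)
  ultimately have "\<exists>Z. zonoid Z \<and>
        (\<forall>y. support_function Z y = integral {0..t} (\<lambda>s. \<bar>y \<bullet> xi s\<bar>)) \<and>
        (\<forall>y. support_function ((*\<^sub>R) \<mu> ` Z) y = \<mu> * integral {0..t} (\<lambda>s. \<bar>y \<bullet> xi s\<bar>)) \<and>
        R = (+) c ` ((*\<^sub>R) \<mu> ` Z)"
    using R by blast
  moreover have "support_function R y = y \<bullet> c + \<mu> * integral {0..t} (\<lambda>s. \<bar>y \<bullet> xi s\<bar>)" for y
    unfolding R by (rule supp)
  moreover have "support_function R_sym y = y \<bullet> ?E + \<mu> * integral {0..t} (\<lambda>s. \<bar>y \<bullet> xi s\<bar>)" for y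
    unfolding R_sym by (rule supp)
  moreover have "support_function R y = support_function R_sym y + y \<bullet> (\<nu> *\<^sub>R zeta t)" for y
    unfolding R R_sym supp translation by (simp add: inner_add_right)
  ultimately show ?thesis by blast
qed

end
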